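(* For every $\mathcal{Z}$-graphon $W$ and every $\mathcal{B}$-decorated graph $\mathbf{F}$, with probability $1$ we have $t(\mathbf{F},\mathbb{G}(n,W))\to t(\mathbf{F},W)$ as $n\to\infty$.
   Context: $\mathcal{B}$ is a separable real Banach space and $\mathcal{Z}$ its dual; $\langle b,z\rangle$ denotes the action of $b\in\mathcal{B}$ on $z\in\mathcal{Z}$. $W:[0,1]^2\to\mathcal{Z}$ is weak-* measurable if $\langle b,W(\cdot,\cdot)\rangle$ is measurable for every $b\in\mathcal{B}$. A $\mathcal{Z}$-graphon is a symmetric weak-* measurable $W:[0,1]^2\to\mathcal{Z}$ such that $(x,y)\mapsto\|W(x,y)\|_{\mathcal{Z}}$ is symmetric and lies in $L^p([0,1]^2)$ for every $1\le p<\infty$. A $\mathcal{B}$-decorated graph $\mathbf{F}=(F,f)$ is a finite simple graph $F$ on $[k]$ with $f:E(F)\to\mathcal{B}$, and $t(\mathbf{F},W)=\int_{[0,1]^k}\prod_{ij\in E(F)}\langle f(ij),W(x_i,x_j)\rangle\,dx$. A $\mathcal{Z}$-decorated complete graph $\mathbf{G}=(G,g)$ on node set $[n]$ assigns to each pair $(u,v)\in[n]^2$ an element $g(u,v)=g(v,u)\in\mathcal{Z}$, and $t(\mathbf{F},\mathbf{G})=n^{-k}\sum_{\varphi:[k]\to[n]}\prod_{ij\in E(F)}\langle f(ij),g(\varphi(i),\varphi(j))\rangle$. The $W$-random $\mathcal{Z}$-decorated graph $\mathbb{G}(n,W)$ on $[n]$: choose independent uniform points $x_1,\dots,x_n\in[0,1]$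 and decorate each pair $ij$ with $i\ne j$ by $W(x_i,x_j)$; pairs $ii$ are decorated by $0\in\mathcal{Z}$. *)

theory Defs
  imports "HOL-Probability.Probability"
begin

text \<open>
  The space \<open>\<B>\<close> is a type \<open>'b\<close> of class \<open>banach\<close>, its dual \<open>\<Z>\<close> is the type \<open>'b \<Rightarrow>\<^sub>L real\<close>
  of bounded linear functionals with the operator norm, and the pairing of \<open>b\<close> with \<open>z\<close> is
  \<open>blinfun_apply z b\<close>. The sets \<open>[k]\<close> and \<open>[n]\<close> are \<open>{1..k}\<close> and \<open>{1..n}\<close>.
\<close>

abbreviation unit_square :: "(real \<times> real) set" where
  "unit_square \<equiv> {0..1} \<times> {0..1}"

text \<open>
  Measurability on the unit square is Lebesgue measurability. The values of a graphon outside
  the unit square are irrelevant.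
\<close>

definition weak_star_measurable :: "(real \<Rightarrow> real \<Rightarrow> 'b::banach \<Rightarrow>\<^sub>L real) \<Rightarrow> bool" where
  "weak_star_measurable W \<longleftrightarrow>
     (\<forall>b. (\<lambda>(x, y). blinfun_apply (W x y) b) \<in> borel_measurable (lebesgue_on unit_square))"

definition in_Lp :: "real \<Rightarrow> 'a measure \<Rightarrow> ('a \<Rightarrow> real) \<Rightarrow> bool" where
  "in_Lp p M h \<longleftrightarrow> h \<in> borel_measurable M \<and> integrable M (\<lambda>x. \<bar>h x\<bar> powr p)"

definition dual_graphon :: "(real \<Rightarrow> real \<Rightarrow> 'b::banach \<Rightarrow>\<^sub>L real) \<Rightarrow> bool" where
  "dual_graphon W \<longleftrightarrow>
     (\<forall>x\<in>{0..1}. \<forall>y\<in>{0..1}. W x y = W y x) \<and>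
     weak_star_measurable W \<and>
     (\<forall>x\<in>{0..1}. \<forall>y\<in>{0..1}. norm (W x y) = norm (W y x)) \<and>
     (\<forall>p\<ge>1. in_Lp p (lebesgue_on unit_square) (\<lambda>(x, y). norm (W x y)))"

record 'b decorated_graph =
  num_nodes :: nat
  edge_set :: "nat set set"
  edge_dec :: "nat set \<Rightarrow> 'b"

definition simple_decorated_graph :: "'b decorated_graph \<Rightarrow> bool" where
  "simple_decorated_graph F \<longleftrightarrow> edge_set F \<subseteq> {e. e \<subseteq> {1..num_nodes F} \<and> card e = 2}"

record 'z decorated_complete_graph =
  num_points :: nat
  pair_dec :: "nat \<Rightarrow> nat \<Rightarrow> 'z"

definition decorated_complete :: "'z decorated_complete_graph \<Rightarrow> bool" where
  "decorated_complete G \<longleftrightarrow>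
     (\<forall>u\<in>{1..num_points G}. \<forall>v\<in>{1..num_points G}. pair_dec G u v = pair_dec G v u)"

text \<open>
  The endpoints of an edge \<open>e\<close> are \<open>Min e\<close> and \<open>Max e\<close>. For symmetric \<open>h\<close> this choice of
  orientation does not matter, see \<open>edge_product_orientation\<close> below.
\<close>

definition edge_product ::
    "('b::banach) decorated_graph \<Rightarrow> (nat \<Rightarrow> nat \<Rightarrow> 'b \<Rightarrow>\<^sub>L real) \<Rightarrow> real" where
  "edge_product F h = (\<Prod>e\<in>edge_set F. blinfun_apply (h (Min e) (Max e)) (edge_dec F e))"

text \<open>
  The completion is needed because for a Lebesgue measurable \<open>W\<close> the integrand is in general
  measurable only for the Lebesgue sets of the cube, not for the product \<open>\<sigma>\<close>-algebra.
\<close>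

definition density_graphon ::
    "('b::banach) decorated_graph \<Rightarrow> (real \<Rightarrow> real \<Rightarrow> 'b \<Rightarrow>\<^sub>L real) \<Rightarrow> real" where
  "density_graphon F W =
     (LINT x | completion (\<Pi>\<^sub>M i\<in>{1..num_nodes F}. restrict_space lborel {0..1}).
        edge_product F (\<lambda>i j. W (x i) (x j)))"

definition density_graph ::
    "('b::banach) decorated_graph \<Rightarrow> ('b \<Rightarrow>\<^sub>L real) decorated_complete_graph \<Rightarrow> real" where
  "density_graph F G =
     (\<Sum>\<phi>\<in>{1..num_nodes F} \<rightarrow>\<^sub>E {1..num_points G}.
        edge_product F (\<lambda>i j. pair_dec G (\<phi> i) (\<phi> j))) / real (num_points G) ^ num_nodes F"

definition sampled_graph ::
    "nat \<Rightarrow> (real \<Rightarrow> real \<Rightarrow> 'b::banach \<Rightarrow>\<^sub>L real) \<Rightarrow> (nat \<Rightarrow> real)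
      \<Rightarrow> ('b \<Rightarrow>\<^sub>L real) decorated_complete_graph" where
  "sampled_graph n W x =
     \<lparr>num_points = n, pair_dec = (\<lambda>i j. if i = j then 0 else W (x i) (x j))\<rparr>"

text \<open>
  The points \<open>x\<^sub>1, \<dots>, x\<^sub>n\<close> behind the \<open>W\<close>-random graph on \<open>[n]\<close>: independent and uniform in
  the unit interval.
\<close>

definition iid_uniform :: "'a measure \<Rightarrow> nat \<Rightarrow> (nat \<Rightarrow> 'a \<Rightarrow> real) \<Rightarrow> bool" where
  "iid_uniform M n X \<longleftrightarrow>
     prob_space.indep_vars M (\<lambda>_. borel) X {1..n} \<and>
     (\<forall>i\<in>{1..n}. distr M lborel (X i) = uniform_measure lborel {0..1})"

lemma edge_product_orientation:
  assumes "simple_decorated_graph F"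
    and "\<And>i j. i \<in> {1..num_nodes F} \<Longrightarrow> j \<in> {1..num_nodes F} \<Longrightarrow> h i j = h j i"
    and "\<And>e. e \<in> edge_set F \<Longrightarrow> e = {a e, b e}"
  shows "edge_product F h = (\<Prod>e\<in>edge_set F. blinfun_apply (h (a e) (b e)) (edge_dec F e))"
  unfolding edge_product_def
proof (rule prod.cong)
  fix e assume e: "e \<in> edge_set F"
  have e2: "e = {a e, b e}" using assms(3)[OF e] .
  have sub: "a e \<in> {1..num_nodes F}" "b e \<in> {1..num_nodes F}"
    using assms(1) e e2 unfolding simple_decorated_graph_def by blast+
  have "Min e = min (a e) (b e)" "Max e = max (a e) (b e)"
    by (subst e2, simp)+
  then have "h (Min e) (Max e) = h (a e) (b e)"
    using assms(2)[OF sub] by (auto simp: min_def max_def)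
  then show "blinfun_apply (h (Min e) (Max e)) (edge_dec F e)
      = blinfun_apply (h (a e) (b e)) (edge_dec F e)" by simp
qed simp

lemma decorated_complete_sampled_graph:
  assumes "dual_graphon W" "\<And>i. i \<in> {1..n} \<Longrightarrow> x i \<in> {0..1}"
  shows "decorated_complete (sampled_graph n W x)"
  using assms by (simp add: decorated_complete_def sampled_graph_def dual_graphon_def)

end

(* Replace each function <f(e), W> by a Borel version. The density of the sampled graph then differs
   from t(F, W) by the average, over all maps phi from [k] to [n], of a deviation Z_phi that depends
   only on the sample points indexed by the image of phi. For injective phi, Z_phi has mean zero,
   and only O(n^(k-1)) maps are not injective. In the expansion of the fourth moment of the sum of
   Z_phi over injective phi, a 4-tuple contributes only if the image of every map meets the image
   of another one, which leaves O(n^(4k-2)) terms, each bounded because W has moments of all orders.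
   So the fourth moment of the error is O(1/n^2). This is summable, which gives almost sure
   convergence without any assumption on the joint law of the samples for different n. *)

theory Submission
  imports Defs
begin

text \<open>Second moments would not be enough: terms that share a sample point are in general
  correlated, so the variance is of order 1/n, which is not summable, and samples with an arbitrary
  joint law offer no way to pass from a subsequence to all n. W is only Lebesgue measurable, so its
  pairing with an edge decoration, evaluated at two sample points, need not be a random variable.
  This forces the passage to Borel versions, one for each edge. Such a version agrees with the
  pairing only off a null set of the square, and the diagonal is itself null; the zero decoration of
  pairs ii keeps the diagonal out of the sampled density, so collapsed edges cause no trouble. The
  limit needs no separate treatment: the coordinates of the cube are a uniform sample of size k, and
  the integrand of t(F, W) is the term of the identity map.\<close>

subsection \<open>Fourth moments\<close>

text \<open>A substitute for the generalized Hoelder inequality: with \<open>c\<close> the sum on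
  the right, each of the \<open>card E\<close> factors of the power \<open>card E\<close> of the
  left side is at most \<open>1 + c\<close>, and taking the root finishes. The summand 1 covers the
  empty product.\<close>

lemma abs_prod_power_le:
  fixes y :: "'e \<Rightarrow> real"
  assumes "finite E"
  shows "\<bar>\<Prod>e\<in>E. y e\<bar> ^ q \<le> 1 + (\<Sum>e\<in>E. \<bar>y e\<bar> ^ (q * card E))"
proof (cases "E = {}")
  case False
  then have m: "card E > 0"
    using assms by (simp add: card_gt_0_iff)
  define c where "c = (\<Sum>e\<in>E. \<bar>y e\<bar> ^ (q * card E))"
  have c: "c \<ge> 0"
    unfolding c_def by (intro sum_nonneg) simp
  have "(\<bar>\<Prod>e\<in>E. y e\<bar> ^ q) ^ card E = (\<Prod>e\<in>E. \<bar>y e\<bar> ^ (q * card E))"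
    by (simp add: abs_prod prod_power_distrib power_mult)
  also have "\<dots> \<le> (\<Prod>e\<in>E. 1 + c)"
  proof (intro prod_mono conjI)
    fix e assume "e \<in> E"
    then have "\<bar>y e\<bar> ^ (q * card E) \<le> c"
      unfolding c_def using assms by (intro member_le_sum) auto
    then show "\<bar>y e\<bar> ^ (q * card E) \<le> 1 + c" by simp
  qed simp
  also have "\<dots> = (1 + c) ^ card E" by simp
  finally have "\<bar>\<Prod>e\<in>E. y e\<bar> ^ q \<le> 1 + c"
    using c m by (subst (asm) power_mono_iff) auto
  then show ?thesis by (simp add: c_def)
qed simp

text \<open>The inequality of arithmetic and geometric means, applied twice to products of two. It
  dominates mixed products by pure fourth powers.\<close>

lemma mult4_le_power4:
  fixes a b c d :: real
  shows "\<bar>a * b * c * d\<bar> \<le> (a ^ 4 + b ^ 4 + c ^ 4 + d ^ 4) / 4"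
proof -
  have *: "\<bar>x * y\<bar> \<le> (x\<^sup>2 + y\<^sup>2) / 2" for x y :: real
    using sum_squares_bound[of "\<bar>x\<bar>" "\<bar>y\<bar>"] by (simp add: abs_mult)
  have "\<bar>a * b * c * d\<bar> = \<bar>(a * b) * (c * d)\<bar>" by (simp add: mult.assoc)
  also have "\<dots> \<le> ((a * b)\<^sup>2 + (c * d)\<^sup>2) / 2" by (rule *)
  also have "\<dots> \<le> (((a\<^sup>2)\<^sup>2 + (b\<^sup>2)\<^sup>2) / 2 + ((c\<^sup>2)\<^sup>2 + (d\<^sup>2)\<^sup>2) / 2) / 2"
    using *[of "a\<^sup>2" "b\<^sup>2"] *[of "c\<^sup>2" "d\<^sup>2"]
    by (intro divide_right_mono add_mono) (simp_all add: power_mult_distrib)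
  finally show ?thesis by (simp flip: power_mult add: field_simps)
qed

text \<open>Squaring the bound for \<open>(x + y)\<^sup>2\<close> and applying it again gives the
  constant 8 = 2^2 * 2.\<close>

lemma power4_add_le:
  fixes a b :: real
  shows "(a + b) ^ 4 \<le> 8 * (a ^ 4 + b ^ 4)"
proof -
  have *: "(x + y)\<^sup>2 \<le> 2 * (x\<^sup>2 + y\<^sup>2)" for x y :: real
    using sum_squares_bound[of x y] by (simp add: power2_sum)
  have "(a + b) ^ 4 = ((a + b)\<^sup>2)\<^sup>2" by (simp flip: power_mult)
  also have "\<dots> \<le> (2 * (a\<^sup>2 + b\<^sup>2))\<^sup>2" by (intro power_mono *) simp
  also have "\<dots> = 4 * (a\<^sup>2 + b\<^sup>2)\<^sup>2" by (simp only: power_mult_distrib) simp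
  also have "\<dots> \<le> 4 * (2 * ((a\<^sup>2)\<^sup>2 + (b\<^sup>2)\<^sup>2))" by (intro mult_left_mono *) simp
  finally show ?thesis by (simp add: power_mult[symmetric])
qed

lemma sum_power4:
  fixes z :: "'i \<Rightarrow> real"
  shows "(\<Sum>a\<in>I. z a) ^ 4 = (\<Sum>a\<in>I. \<Sum>b\<in>I. \<Sum>c\<in>I. \<Sum>d\<in>I. z a * z b * z c * z d)"
proof -
  have "(\<Sum>a\<in>I. z a) ^ 4 = (\<Sum>a\<in>I. z a) * ((\<Sum>a\<in>I. z a) * ((\<Sum>a\<in>I. z a) * (\<Sum>a\<in>I. z a)))"
    by (simp add: power4_eq_xxxx mult.assoc)
  also have "\<dots> = (\<Sum>a\<in>I. \<Sum>b\<in>I. \<Sum>c\<in>I. \<Sum>d\<in>I. z a * z b * z c * z d)"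
    by (simp add: sum_distrib_left sum_distrib_right mult.assoc)
       (intro sum.cong refl, simp add: mult_ac)
  finally show ?thesis .
qed

text \<open>
  In a 4-tuple with nonzero expectation every entry is related to another one, and a graph on
  four vertices without isolated vertices contains a perfect matching or a spanning star.
\<close>

lemma (in finite_measure) fourth_moment_sum_le:
  fixes Z :: "'i \<Rightarrow> 'a \<Rightarrow> real"
  assumes fin: "finite I"
    and meas: "\<And>a. a \<in> I \<Longrightarrow> Z a \<in> borel_measurable M"
    and int: "\<And>a. a \<in> I \<Longrightarrow> integrable M (\<lambda>\<omega>. Z a \<omega> ^ 4)"
    and bound: "\<And>a. a \<in> I \<Longrightarrow> (\<integral>\<omega>. Z a \<omega> ^ 4 \<partial>M) \<le> C"
    and R_sym: "\<And>a b. R a b \<longleftrightarrow> R b a"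
    and deg: "\<And>a. a \<in> I \<Longrightarrow> real (card {b\<in>I. R a b}) \<le> D"
    and orth: "\<And>a b c d. {a, b, c, d} \<subseteq> I \<Longrightarrow> \<not> R a b \<Longrightarrow> \<not> R a c \<Longrightarrow> \<not> R a d \<Longrightarrow>
      (\<integral>\<omega>. Z a \<omega> * (Z b \<omega> * Z c \<omega> * Z d \<omega>) \<partial>M) = 0"
  shows "integrable M (\<lambda>\<omega>. (\<Sum>a\<in>I. Z a \<omega>) ^ 4)"
    and "(\<integral>\<omega>. (\<Sum>a\<in>I. Z a \<omega>) ^ 4 \<partial>M) \<le> 7 * C * (real (card I) * D)\<^sup>2"
proof -
  define r :: "'i \<Rightarrow> 'i \<Rightarrow> real" where "r a b = of_bool (R a b)" for a b
  define m where "m a b c d = (\<integral>\<omega>. Z a \<omega> * Z b \<omega> * Z c \<omega> * Z d \<omega> \<partial>M)" for a b c d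
  have int4: "integrable M (\<lambda>\<omega>. Z a \<omega> * Z b \<omega> * Z c \<omega> * Z d \<omega>)" (is "integrable M ?f")
    and m_le: "m a b c d \<le> C"
    if "a \<in> I" "b \<in> I" "c \<in> I" "d \<in> I" for a b c d
  proof -
    let ?g = "\<lambda>\<omega>. (Z a \<omega> ^ 4 + Z b \<omega> ^ 4 + Z c \<omega> ^ 4 + Z d \<omega> ^ 4) / 4"
    note [measurable] = that[THEN meas]
    have g: "integrable M ?g"
      by (intro integrable_divide Bochner_Integration.integrable_add int that)
    show i: "integrable M ?f"
      by (rule Bochner_Integration.integrable_bound[OF g])
        (use mult4_le_power4 in \<open>auto intro!: AE_I2 intro: order_trans\<close>)
    have "m a b c d \<le> (\<integral>\<omega>. ?g \<omega> \<partial>M)"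
      unfolding m_def by (intro integral_mono i g) (rule order_trans[OF abs_ge_self mult4_le_power4])
    also have "\<dots> \<le> C"
      using that[THEN bound] that[THEN int] by simp
    finally show "m a b c d \<le> C" .
  qed
  show "integrable M (\<lambda>\<omega>. (\<Sum>a\<in>I. Z a \<omega>) ^ 4)"
    unfolding sum_power4 by (intro Bochner_Integration.integrable_sum int4)
  have C: "0 \<le> C" if "a \<in> I" for a
    by (rule order_trans[OF _ bound[OF that]]) simp
  \<comment> \<open>Indicators of the three perfect matchings on the vertices a, b, c, d and of the
    four spanning stars. These seven terms are the origin of the factor 7.\<close>
  define B where "B a b c d = r a b * r c d + r a c * r b d + r a d * r b c + r a b * r a c * r a d
    + r b a * r b c * r b d + r c a * r c b * r c d + r d a * r d b * r d c" for a b c d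
  have rs: "r a b = r b a" for a b
    using R_sym by (simp add: r_def)
  have r_nonneg: "0 \<le> r a b" for a b
    by (simp add: r_def)
  have m_le_B: "m a b c d \<le> C * B a b c d" if *: "a \<in> I" "b \<in> I" "c \<in> I" "d \<in> I" for a b c d
  proof (cases "(\<not> R a b \<and> \<not> R a c \<and> \<not> R a d) \<or> (\<not> R b a \<and> \<not> R b c \<and> \<not> R b d)
    \<or> (\<not> R c a \<and> \<not> R c b \<and> \<not> R c d) \<or> (\<not> R d a \<and> \<not> R d b \<and> \<not> R d c)")
    \<comment> \<open>Some vertex is isolated. Moving its factor to the front makes
      \<open>orth\<close> applicable.\<close>
    case True
    have eq: "m a b c d = (\<integral>\<omega>. Z a \<omega> * (Z b \<omega> * Z c \<omega> * Z d \<omega>) \<partial>M)"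
      "m a b c d = (\<integral>\<omega>. Z b \<omega> * (Z a \<omega> * Z c \<omega> * Z d \<omega>) \<partial>M)"
      "m a b c d = (\<integral>\<omega>. Z c \<omega> * (Z a \<omega> * Z b \<omega> * Z d \<omega>) \<partial>M)"
      "m a b c d = (\<integral>\<omega>. Z d \<omega> * (Z a \<omega> * Z b \<omega> * Z c \<omega>) \<partial>M)"
      unfolding m_def by (simp_all add: mult_ac)
    from True consider "\<not> R a b" "\<not> R a c" "\<not> R a d" | "\<not> R b a" "\<not> R b c" "\<not> R b d"
      | "\<not> R c a" "\<not> R c b" "\<not> R c d" | "\<not> R d a" "\<not> R d b" "\<not> R d c"
      by blast
    then have "m a b c d = 0"
    proof cases
      case 1 then show ?thesis unfolding eq(1) using * by (intro orth) auto
    next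
      case 2 then show ?thesis unfolding eq(2) using * by (intro orth) auto
    next
      case 3 then show ?thesis unfolding eq(3) using * by (intro orth) auto
    next
      case 4 then show ?thesis unfolding eq(4) using * by (intro orth) auto
    qed
    moreover have "0 \<le> C * B a b c d"
      unfolding B_def by (intro mult_nonneg_nonneg add_nonneg_nonneg C[OF *(1)] r_nonneg)
    ultimately show ?thesis by simp
  next
    case False
    \<comment> \<open>The variables x, y, z, u, v, t stand for the edges ab, ac, ad, bc, bd, cd. The
      four premises say that no vertex is isolated, and the summands are those of
      \<open>B\<close>.\<close>
    have "1 \<le> (of_bool (x \<and> t) + of_bool (y \<and> v) + of_bool (z \<and> u) + of_bool (x \<and> y \<and> z)
        + of_bool (x \<and> u \<and> v) + of_bool (y \<and> u \<and> t) + of_bool (z \<and> v \<and> t) :: real)"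
      if "x \<or> y \<or> z" "x \<or> u \<or> v" "y \<or> u \<or> t" "z \<or> v \<or> t" for x y z u v t
      using that by (cases x; cases y; cases z; cases u; cases v; cases t) simp_all
    from this[of "R a b" "R a c" "R a d" "R b c" "R b d" "R c d"] False have "1 \<le> B a b c d"
      unfolding B_def r_def R_sym[of b a] R_sym[of c a] R_sym[of d a] R_sym[of c b] R_sym[of d b]
        R_sym[of d c] of_bool_conj by (simp add: mult.assoc)
    then have "C * 1 \<le> C * B a b c d"
      using C[OF *(1)] by (intro mult_left_mono) auto
    then show ?thesis using m_le[OF *] by simp
  qed
  have r_sum: "(\<Sum>b\<in>I. r a b) = card {b\<in>I. R a b}" for a
    using fin by (simp add: r_def Int_def)
  let ?N = "real (card I)"
  let ?S = "\<lambda>f. \<Sum>a\<in>I. \<Sum>b\<in>I. \<Sum>c\<in>I. \<Sum>d\<in>I. f a b c d :: real"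
  have pair: "(\<Sum>a\<in>I. \<Sum>b\<in>I. r a b) \<le> ?N * D"
    using sum_mono[of I "\<lambda>a. \<Sum>b\<in>I. r a b" "\<lambda>_. D"] deg by (simp add: r_sum)
  have "?S (\<lambda>a b c d. r a b * r c d) = (\<Sum>a\<in>I. \<Sum>b\<in>I. r a b)\<^sup>2"
    by (simp add: power2_eq_square sum_distrib_left sum_distrib_right)
      (intro sum.cong refl, simp add: mult_ac)
  also have "\<dots> \<le> (?N * D)\<^sup>2"
    by (intro power_mono pair sum_nonneg) (simp add: r_def)
  finally have matching: "?S (\<lambda>a b c d. r a b * r c d) \<le> (?N * D)\<^sup>2" .
  have "?S (\<lambda>a b c d. r a b * r a c * r a d) = (\<Sum>a\<in>I. (\<Sum>b\<in>I. r a b) ^ 3)"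
    by (simp add: power3_eq_cube sum_distrib_left sum_distrib_right)
      (intro sum.cong refl, simp add: mult_ac)
  \<comment> \<open>Two of the three degree factors are bounded by \<open>D\<close> and the third by
    \<open>card I\<close>, which gives stars the same bound as matchings.\<close>
  also have "\<dots> \<le> (\<Sum>a\<in>I. D * D * ?N)"
  proof (intro sum_mono)
    fix a assume "a \<in> I"
    note d = deg[OF this]
    have "card {b\<in>I. R a b} \<le> card I"
      using fin by (intro card_mono) auto
    then show "(\<Sum>b\<in>I. r a b) ^ 3 \<le> D * D * ?N"
      unfolding r_sum power3_eq_cube using d by (intro mult_mono) auto
  qed
  also have "\<dots> = (?N * D)\<^sup>2" by (simp add: power2_eq_square)
  finally have star: "?S (\<lambda>a b c d. r a b * r a c * r a d) \<le> (?N * D)\<^sup>2" .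
  \<comment> \<open>Adjacent transpositions of the summation order. They rename the vertices and so
    reduce all matchings and all stars to the two cases already bounded.\<close>
  have sw: "?S f = ?S (\<lambda>a b c d. f b a c d)" "?S f = ?S (\<lambda>a b c d. f a c b d)"
    "?S f = ?S (\<lambda>a b c d. f a b d c)" for f
    subgoal by (rule sum.swap)
    subgoal by (rule sum.cong[OF refl], rule sum.swap)
    subgoal by (rule sum.cong[OF refl], rule sum.cong[OF refl], rule sum.swap)
    done
  have S2: "?S (\<lambda>a b c d. r a c * r b d) = ?S (\<lambda>a b c d. r a b * r c d)"
    by (subst sw(2)) simp
  have S3: "?S (\<lambda>a b c d. r a d * r b c) = ?S (\<lambda>a b c d. r a b * r c d)"
    by (subst sw(3), subst sw(2)) (simp add: rs)
  have S5: "?S (\<lambda>a b c d. r b a * r b c * r b d) = ?S (\<lambda>a b c d. r a b * r a c * r a d)"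
    by (subst sw(1)) simp
  have S6: "?S (\<lambda>a b c d. r c a * r c b * r c d) = ?S (\<lambda>a b c d. r a b * r a c * r a d)"
    by (subst sw(2), subst sw(1)) simp
  have S7: "?S (\<lambda>a b c d. r d a * r d b * r d c) = ?S (\<lambda>a b c d. r a b * r a c * r a d)"
    by (subst sw(3), subst sw(2), subst sw(1)) simp
  have SB: "?S B \<le> 7 * (?N * D)\<^sup>2"
    unfolding B_def sum.distrib S2 S3 S5 S6 S7 using matching star by simp
  have "(\<integral>\<omega>. (\<Sum>a\<in>I. Z a \<omega>) ^ 4 \<partial>M) = ?S m"
    unfolding sum_power4 m_def by (simp add: int4 Bochner_Integration.integrable_sum)
  also have "\<dots> \<le> ?S (\<lambda>a b c d. C * B a b c d)"
    by (intro sum_mono m_le_B)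
  also have "\<dots> = C * ?S B"
    by (simp add: sum_distrib_left)
  also have "\<dots> \<le> 7 * C * (?N * D)\<^sup>2"
  proof (cases "I = {}")
    case False
    then obtain a where "a \<in> I" by blast
    from mult_left_mono[OF SB C[OF this]] show ?thesis by simp
  qed simp
  finally show "(\<integral>\<omega>. (\<Sum>a\<in>I. Z a \<omega>) ^ 4 \<partial>M) \<le> 7 * C * (?N * D)\<^sup>2" .
qed

text \<open>By monotone convergence the series of the fourth powers has a finite integral, so it
  converges almost everywhere and its terms tend to zero. Only the individual moments enter, never
  the joint law.\<close>

lemma AE_tendsto_zero_if_summable_power4:
  fixes S :: "nat \<Rightarrow> 'a \<Rightarrow> real"
  assumes int: "\<And>n. integrable M (\<lambda>\<omega>. S n \<omega> ^ 4)"
    and summ: "summable (\<lambda>n. \<integral>\<omega>. S n \<omega> ^ 4 \<partial>M)"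
  shows "AE \<omega> in M. (\<lambda>n. S n \<omega>) \<longlonglongrightarrow> 0"
proof -
  note [measurable] = borel_measurable_integrable[OF int]
  have "(\<integral>\<^sup>+\<omega>. (\<Sum>n. ennreal (S n \<omega> ^ 4)) \<partial>M) = (\<Sum>n. \<integral>\<^sup>+\<omega>. ennreal (S n \<omega> ^ 4) \<partial>M)"
    by (intro nn_integral_suminf) simp
  also have "\<dots> = (\<Sum>n. ennreal (\<integral>\<omega>. S n \<omega> ^ 4 \<partial>M))"
    by (intro suminf_cong nn_integral_eq_integral int) simp
  also have "\<dots> \<noteq> \<infinity>"
    using summ by (subst suminf_ennreal2) auto
  finally have "AE \<omega> in M. (\<Sum>n. ennreal (S n \<omega> ^ 4)) \<noteq> \<infinity>"
    by (intro nn_integral_PInf_AE) simp_all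
  then show ?thesis
  proof eventually_elim
    fix \<omega> assume "(\<Sum>n. ennreal (S n \<omega> ^ 4)) \<noteq> \<infinity>"
    then have "summable (\<lambda>n. S n \<omega> ^ 4)"
      by (intro summable_suminf_not_top) auto
    then have "(\<lambda>n. S n \<omega> ^ 4) \<longlonglongrightarrow> 0"
      by (rule summable_LIMSEQ_zero)
    from tendsto_real_root[OF this, of 4] have "(\<lambda>n. root 4 (\<bar>S n \<omega>\<bar> ^ 4)) \<longlonglongrightarrow> 0"
      by simp
    then have "(\<lambda>n. \<bar>S n \<omega>\<bar>) \<longlonglongrightarrow> 0"
      by (subst (asm) real_root_power_cancel) simp_all
    then show "(\<lambda>n. S n \<omega>) \<longlonglongrightarrow> 0"
      by (simp add: tendsto_rabs_zero_iff)
  qed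
qed

subsection \<open>Counting maps\<close>

lemma card_PiE_fix_le:
  assumes "finite K" "finite N" "j \<in> K"
  shows "card {\<psi> \<in> K \<rightarrow>\<^sub>E N. \<psi> j = v} \<le> card N ^ (card K - 1)"
proof -
  let ?T = "\<lambda>l. if l = j then {v} else N"
  have "{\<psi> \<in> K \<rightarrow>\<^sub>E N. \<psi> j = v} \<subseteq> PiE K ?T"
    by (auto simp: PiE_iff extensional_def)
  then have "card {\<psi> \<in> K \<rightarrow>\<^sub>E N. \<psi> j = v} \<le> card (PiE K ?T)"
    by (rule card_mono[rotated]) (use assms in \<open>auto intro!: finite_PiE\<close>)
  also have "\<dots> = card N ^ (card K - 1)"
    using assms by (simp add: card_PiE prod.remove[of _ j])
  finally show ?thesis .
qed

text \<open>A union bound over the positions (i, j) with \<open>\<psi> j = \<phi> i\<close>, each of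
  which fixes one value of \<psi>. The loss of one power of \<open>card N\<close> against all maps,
  once for each of two pairs in a 4-tuple, produces the rate 1/n^2.\<close>

lemma card_PiE_meet_le:
  assumes "finite K" "finite N"
  shows "card {\<psi> \<in> K \<rightarrow>\<^sub>E N. \<phi> ` K \<inter> \<psi> ` K \<noteq> {}} \<le> (card K)\<^sup>2 * card N ^ (card K - 1)"
proof -
  let ?f = "\<lambda>p. {\<psi> \<in> K \<rightarrow>\<^sub>E N. \<psi> (snd p) = \<phi> (fst p)}"
  have "{\<psi> \<in> K \<rightarrow>\<^sub>E N. \<phi> ` K \<inter> \<psi> ` K \<noteq> {}} \<subseteq> (\<Union>p\<in>K \<times> K. ?f p)"
  proof
    fix \<psi> assume "\<psi> \<in> {\<psi> \<in> K \<rightarrow>\<^sub>E N. \<phi> ` K \<inter> \<psi> ` K \<noteq> {}}"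
    then obtain i j where "i \<in> K" "j \<in> K" "\<psi> j = \<phi> i" "\<psi> \<in> K \<rightarrow>\<^sub>E N"
      by auto metis
    then show "\<psi> \<in> (\<Union>p\<in>K \<times> K. ?f p)"
      by (intro UN_I[of "(i, j)"]) auto
  qed
  then have "card {\<psi> \<in> K \<rightarrow>\<^sub>E N. \<phi> ` K \<inter> \<psi> ` K \<noteq> {}} \<le> card (\<Union>p\<in>K \<times> K. ?f p)"
    using assms by (intro card_mono) (auto intro!: finite_PiE)
  also have "\<dots> \<le> (\<Sum>p\<in>K \<times> K. card (?f p))"
    using assms by (intro card_UN_le) auto
  also have "\<dots> \<le> (\<Sum>p\<in>K \<times> K. card N ^ (card K - 1))"
    by (intro sum_mono card_PiE_fix_le assms) auto
  finally show ?thesis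
    by (simp add: power2_eq_square card_cartesian_product)
qed

lemma card_PiE_eq_le:
  assumes fin: "finite K" "finite N" and ij: "i \<in> K" "j \<in> K" "i \<noteq> j"
  shows "card {\<psi> \<in> K \<rightarrow>\<^sub>E N. \<psi> i = \<psi> j} \<le> card N ^ (card K - 1)"
proof -
  let ?A = "{\<psi> \<in> K \<rightarrow>\<^sub>E N. \<psi> i = \<psi> j}"
  have "inj_on (\<lambda>\<psi>. restrict \<psi> (K - {j})) ?A"
  proof (rule inj_onI)
    fix \<psi> \<psi>' assume *: "\<psi> \<in> ?A" "\<psi>' \<in> ?A" "restrict \<psi> (K - {j}) = restrict \<psi>' (K - {j})"
    have eq: "\<psi> l = \<psi>' l" if "l \<in> K - {j}" for l
      using that fun_cong[OF *(3), of l] by simp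
    show "\<psi> = \<psi>'"
    proof (rule PiE_ext[of _ K "\<lambda>_. N"])
      fix l assume "l \<in> K"
      then show "\<psi> l = \<psi>' l"
        using *(1,2) eq[of l] eq[of i] ij by (cases "l = j") auto
    qed (use * in auto)
  qed
  moreover have "(\<lambda>\<psi>. restrict \<psi> (K - {j})) ` ?A \<subseteq> (K - {j}) \<rightarrow>\<^sub>E N"
    by (auto simp: PiE_iff split: if_splits)
  ultimately have "card ?A \<le> card ((K - {j}) \<rightarrow>\<^sub>E N)"
    by (rule card_inj_on_le) (use fin in \<open>auto intro!: finite_PiE\<close>)
  also have "\<dots> = card N ^ (card K - 1)"
    using fin ij by (simp add: card_PiE)
  finally show ?thesis .
qed

text \<open>A union bound over the pairs of positions that can collide; a prescribed collision
  removes one free value.\<close>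

lemma card_PiE_not_inj_le:
  assumes fin: "finite K" "finite N"
  shows "card {\<psi> \<in> K \<rightarrow>\<^sub>E N. \<not> inj_on \<psi> K} \<le> (card K)\<^sup>2 * card N ^ (card K - 1)"
proof -
  let ?f = "\<lambda>p. {\<psi> \<in> K \<rightarrow>\<^sub>E N. \<psi> (fst p) = \<psi> (snd p)}"
  let ?P = "{p \<in> K \<times> K. fst p \<noteq> snd p}"
  have P: "finite ?P" "card ?P \<le> card (K \<times> K)"
    using fin by simp (rule card_mono, use fin in auto)
  have "{\<psi> \<in> K \<rightarrow>\<^sub>E N. \<not> inj_on \<psi> K} \<subseteq> (\<Union>p\<in>?P. ?f p)"
  proof
    fix \<psi> assume "\<psi> \<in> {\<psi> \<in> K \<rightarrow>\<^sub>E N. \<not> inj_on \<psi> K}"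
    then obtain i j where "i \<in> K" "j \<in> K" "\<psi> i = \<psi> j" "i \<noteq> j" "\<psi> \<in> K \<rightarrow>\<^sub>E N"
      by (auto simp: inj_on_def)
    then show "\<psi> \<in> (\<Union>p\<in>?P. ?f p)"
      by (intro UN_I[of "(i, j)"]) auto
  qed
  then have "card {\<psi> \<in> K \<rightarrow>\<^sub>E N. \<not> inj_on \<psi> K} \<le> card (\<Union>p\<in>?P. ?f p)"
    using fin P by (intro card_mono) (auto intro!: finite_PiE)
  also have "\<dots> \<le> (\<Sum>p\<in>?P. card (?f p))"
    using P by (intro card_UN_le) auto
  also have "\<dots> \<le> (\<Sum>p\<in>?P. card N ^ (card K - 1))"
    by (intro sum_mono card_PiE_eq_le fin) auto
  also have "\<dots> \<le> (card K)\<^sup>2 * card N ^ (card K - 1)"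
    using P by (simp add: power2_eq_square card_cartesian_product)
  finally show ?thesis .
qed

subsection \<open>Uniform samples\<close>

abbreviation uniform_unit :: "real measure" where
  "uniform_unit \<equiv> uniform_measure lborel {0..1}"

lemma prob_space_uniform_unit: "prob_space uniform_unit"
  by (rule prob_space_uniform_measure) auto

text \<open>Bridges the two encodings of the uniform law: the density of a graphon integrates over
  the space [0,1] itself, while sample points are real random variables.\<close>

lemma uniform_unit_eq_distr:
  "uniform_unit = distr (restrict_space lborel {0..1}) borel (\<lambda>x. x)"
proof (rule measure_eqI)
  fix A assume "A \<in> sets uniform_unit"
  then have [measurable]: "A \<in> sets borel" by simp
  have id: "(\<lambda>x. x) \<in> restrict_space lborel {0..1::real} \<rightarrow>\<^sub>M borel"
    by (intro measurable_restrict_space1) simp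
  show "emeasure uniform_unit A
      = emeasure (distr (restrict_space lborel {0..1}) borel (\<lambda>x. x)) A"
    by (subst emeasure_distr[OF id])
      (simp_all add: space_restrict_space emeasure_restrict_space Int_commute divide_ennreal_def)
qed simp

lemma unit_square_borel: "unit_square \<in> sets borel"
  by (metis atLeastAtMost_borel borel_prod pair_measureI)

text \<open>Turns the law of two independent points into Lebesgue measure on the square, where the
  assumptions on a graphon are stated.\<close>

lemma uniform_unit_pair:
  "uniform_unit \<Otimes>\<^sub>M uniform_unit = uniform_measure lborel unit_square"
proof (rule pair_measure_eqI)
  show "sigma_finite_measure uniform_unit"
    using prob_space_uniform_unit by (rule prob_space_imp_sigma_finite)
  then show "sigma_finite_measure uniform_unit" .
  show "sets (uniform_unit \<Otimes>\<^sub>M uniform_unit) = sets (uniform_measure lborel unit_square)"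
    using sets_pair_measure_cong[of uniform_unit borel uniform_unit borel] by (simp flip: borel_prod)
  fix A B assume "A \<in> sets uniform_unit" "B \<in> sets uniform_unit"
  then have [measurable]: "A \<in> sets borel" "B \<in> sets borel" by simp_all
  have L: "emeasure lborel (S \<times> T) = emeasure lborel S * emeasure lborel T"
    if "S \<in> sets borel" "T \<in> sets borel" for S T :: "real set"
    using that lborel.emeasure_pair_measure_Times[of S lborel T] by (simp add: lborel_prod)
  have [measurable]: "A \<times> B \<in> sets borel"
    by (metis \<open>A \<in> sets borel\<close> \<open>B \<in> sets borel\<close> borel_prod pair_measureI)
  show "emeasure uniform_unit A * emeasure uniform_unit B
      = emeasure (uniform_measure lborel unit_square) (A \<times> B)"
    using unit_square_borel by (simp add: L Times_Int_Times divide_ennreal_def)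
qed

locale uniform_sample = prob_space M for M :: "'a measure" +
  fixes n :: nat and X :: "nat \<Rightarrow> 'a \<Rightarrow> real"
  assumes iid: "iid_uniform M n X"
begin

lemma indep: "indep_vars (\<lambda>_. borel) X {1..n}"
  using iid by (simp add: iid_uniform_def)

lemma measurable_sample [measurable]: "i \<in> {1..n} \<Longrightarrow> X i \<in> borel_measurable M"
  using indep by (simp add: indep_vars_def)

lemma distr_sample: "i \<in> {1..n} \<Longrightarrow> distr M borel (X i) = uniform_unit"
  using iid by (simp add: iid_uniform_def cong: distr_cong)

lemma indep_disjoint:
  assumes "A \<subseteq> {1..n}" "B \<subseteq> {1..n}" "A \<inter> B = {}"
    and "f \<in> borel_measurable (PiM A (\<lambda>_. borel))" "g \<in> borel_measurable (PiM B (\<lambda>_. borel))"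
  shows "indep_var borel (\<lambda>\<omega>. f (\<lambda>i\<in>A. X i \<omega>)) borel (\<lambda>\<omega>. g (\<lambda>i\<in>B. X i \<omega>))"
  using indep_var_compose[OF indep_var_restrict[OF indep assms(3,1,2)] assms(4,5)]
  by (simp add: comp_def)

lemma distr_sample_pair:
  assumes "i \<in> {1..n}" "j \<in> {1..n}" "i \<noteq> j"
  shows "distr M borel (\<lambda>\<omega>. (X i \<omega>, X j \<omega>)) = uniform_measure lborel unit_square"
proof -
  have "indep_var borel (\<lambda>\<omega>. (\<lambda>l\<in>{i}. X l \<omega>) i) borel (\<lambda>\<omega>. (\<lambda>l\<in>{j}. X l \<omega>) j)"
    using assms by (intro indep_disjoint[where f = "\<lambda>x. x i" and g = "\<lambda>x. x j"]) auto
  then have "indep_var borel (X i) borel (X j)" by simp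
  then show ?thesis
    using assms by (simp add: indep_var_distribution_eq distr_sample uniform_unit_pair borel_prod)
qed

lemma distr_sample_tuple:
  fixes k :: nat
  assumes \<phi>: "inj_on \<phi> {1..k}" "\<phi> \<in> {1..k} \<rightarrow> {1..n}" and k: "k > 0"
  shows "distr M (PiM {1..k} (\<lambda>_. borel)) (\<lambda>\<omega>. \<lambda>i\<in>{1..k}. X (\<phi> i) \<omega>)
    = PiM {1..k} (\<lambda>_. uniform_unit)"
proof -
  \<comment> \<open>Independence is characterized by the product law only for a nonempty index set;
    a positive \<open>k\<close> supplies one.\<close>
  have "1 \<in> {1..k}" using k by (simp add: Suc_le_eq)
  with \<phi>(2) have n: "{1..n} \<noteq> {}" by blast
  have joint: "distr M (PiM {1..n} (\<lambda>_. borel)) (\<lambda>\<omega>. \<lambda>i\<in>{1..n}. X i \<omega>)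
      = PiM {1..n} (\<lambda>_. uniform_unit)"
    using indep_vars_iff_distr_eq_PiM'[THEN iffD1, OF n measurable_sample indep]
      PiM_cong[OF refl distr_sample, of "{1..n}"] by simp
  \<comment> \<open>Selecting coordinates along an injective map sends a product of equal
    probability measures to such a product.\<close>
  have "distr (PiM {1..n} (\<lambda>_. uniform_unit)) (PiM {1..k} (\<lambda>_. uniform_unit))
      (\<lambda>x. \<lambda>i\<in>{1..k}. x (\<phi> i)) = PiM {1..k} (\<lambda>_. uniform_unit)"
    by (intro distr_PiM_reindex prob_space_uniform_unit \<phi>)
  then have "PiM {1..k} (\<lambda>_. uniform_unit)
      = distr (distr M (PiM {1..n} (\<lambda>_. borel)) (\<lambda>\<omega>. \<lambda>i\<in>{1..n}. X i \<omega>))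
          (PiM {1..k} (\<lambda>_. uniform_unit)) (\<lambda>x. \<lambda>i\<in>{1..k}. x (\<phi> i))"
    by (simp only: joint)
  also have "\<dots> = distr (distr M (PiM {1..n} (\<lambda>_. borel)) (\<lambda>\<omega>. \<lambda>i\<in>{1..n}. X i \<omega>))
          (PiM {1..k} (\<lambda>_. borel)) (\<lambda>x. \<lambda>i\<in>{1..k}. x (\<phi> i))"
    by (intro distr_cong refl sets_PiM_cong) auto
  also have "\<dots> = distr M (PiM {1..k} (\<lambda>_. borel))
      ((\<lambda>x. \<lambda>i\<in>{1..k}. x (\<phi> i)) \<circ> (\<lambda>\<omega>. \<lambda>i\<in>{1..n}. X i \<omega>))"
    using \<phi>(2) by (intro distr_distr) (auto intro!: measurable_restrict measurable_component_singleton)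
  also have "(\<lambda>x. \<lambda>i\<in>{1..k}. x (\<phi> i)) \<circ> (\<lambda>\<omega>. \<lambda>i\<in>{1..n}. X i \<omega>)
      = (\<lambda>\<omega>. \<lambda>i\<in>{1..k}. X (\<phi> i) \<omega>)"
    using \<phi>(2) by (fastforce simp: fun_eq_iff)
  finally show ?thesis ..
qed

text \<open>The pair of points is uniform on the square, so null sets pull back to null events.
  Distinct indices are essential: with \<open>i = j\<close> the pair would lie on the diagonal,
  which is null. The function \<open>g\<close> may be any function, such as the original pairing
  with the graphon.\<close>

lemma AE_sample_pair:
  assumes "i \<in> {1..n}" "j \<in> {1..n}" "i \<noteq> j"
    and "AE z in lborel. z \<in> unit_square \<longrightarrow> f z = g (fst z) (snd z)"
  shows "AE \<omega> in M. f (X i \<omega>, X j \<omega>) = g (X i \<omega>) (X j \<omega>)"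
proof -
  have "AE \<omega> in M. (\<lambda>z. f z = g (fst z) (snd z)) (X i \<omega>, X j \<omega>)"
  proof (rule AE_distrD[where M' = borel and P = "\<lambda>z. f z = g (fst z) (snd z)"])
    have "AE z in uniform_measure lborel unit_square. f z = g (fst z) (snd z)"
      using unit_square_borel by (intro AE_uniform_measureI assms(4)) simp
    then show "AE z in distr M borel (\<lambda>\<omega>. (X i \<omega>, X j \<omega>)). f z = g (fst z) (snd z)"
      unfolding distr_sample_pair[OF assms(1-3)] .
  qed (use assms in measurable)
  then show ?thesis by simp
qed

end

text \<open>Makes the cube behind \<open>density_graphon\<close> an instance of the sampling model,
  so that facts about samples also evaluate the limit.\<close>

lemma iid_uniform_coordinates:
  "iid_uniform (\<Pi>\<^sub>M i\<in>{1..k}. restrict_space lborel {0..1}) k (\<lambda>i x. x i)"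
proof -
  let ?R = "restrict_space lborel {0..1::real}"
  have R: "prob_space ?R"
    by (rule prob_space_restrict_space) simp_all
  interpret prob_space "\<Pi>\<^sub>M i\<in>{1..k}. ?R"
    by (rule prob_space_PiM) (rule R)
  have id: "(\<lambda>x. x) \<in> ?R \<rightarrow>\<^sub>M borel"
    by (intro measurable_restrict_space1) simp
  have meas: "(\<lambda>x. x i) \<in> borel_measurable (\<Pi>\<^sub>M i\<in>{1..k}. ?R)" if "i \<in> {1..k}" for i
    using measurable_compose[OF measurable_component_singleton[OF that] id] .
  have one: "distr (\<Pi>\<^sub>M i\<in>{1..k}. ?R) borel (\<lambda>x. x i) = uniform_unit" if "i \<in> {1..k}" for i
  proof -
    have "uniform_unit = distr (distr (\<Pi>\<^sub>M i\<in>{1..k}. ?R) ?R (\<lambda>x. x i)) borel (\<lambda>x. x)"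
      unfolding uniform_unit_eq_distr using that R by (subst distr_PiM_component) auto
    also have "\<dots> = distr (\<Pi>\<^sub>M i\<in>{1..k}. ?R) borel ((\<lambda>x. x) \<circ> (\<lambda>x. x i))"
      by (rule distr_distr[OF id]) (rule measurable_component_singleton[OF that])
    finally show ?thesis by (simp add: comp_def)
  qed
  have "indep_vars (\<lambda>_. borel) (\<lambda>i x. x i) {1..k}"
  proof (cases "k = 0")
    case True
    \<comment> \<open>The product characterization used for positive \<open>k\<close> needs a
      nonempty index set; an empty family is independent by definition.\<close>
    then show ?thesis unfolding indep_vars_def indep_sets_def by auto
  next
    case False
    have "distr (\<Pi>\<^sub>M i\<in>{1..k}. ?R) (\<Pi>\<^sub>M i\<in>{1..k}. borel) (compose {1..k} (\<lambda>x. x))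
        = distr (\<Pi>\<^sub>M i\<in>{1..k}. ?R) (\<Pi>\<^sub>M i\<in>{1..k}. uniform_unit) (compose {1..k} (\<lambda>x. x))"
      by (intro distr_cong refl sets_PiM_cong) auto
    also have "\<dots> = (\<Pi>\<^sub>M i\<in>{1..k}. distr ?R uniform_unit (\<lambda>x. x))"
      using id by (intro distr_PiM_finite_prob_space' R prob_space_uniform_unit)
        (auto cong: measurable_cong_sets)
    also have "distr ?R uniform_unit (\<lambda>x. x) = distr ?R borel (\<lambda>x. x)"
      by (intro distr_cong) auto
    finally have "distr (\<Pi>\<^sub>M i\<in>{1..k}. ?R) (\<Pi>\<^sub>M i\<in>{1..k}. borel) (compose {1..k} (\<lambda>x. x))
        = (\<Pi>\<^sub>M i\<in>{1..k}. distr ?R borel (\<lambda>x. x))" .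
    moreover have "compose {1..k} (\<lambda>x. x) = (\<lambda>x. \<lambda>i\<in>{1..k}. x i :: real)"
      by (simp add: compose_def fun_eq_iff)
    moreover have "(\<Pi>\<^sub>M i\<in>{1..k}. distr ?R borel (\<lambda>x. x))
        = (\<Pi>\<^sub>M i\<in>{1..k}. distr (\<Pi>\<^sub>M i\<in>{1..k}. ?R) borel (\<lambda>x. x i))"
      by (intro PiM_cong refl) (simp only: one uniform_unit_eq_distr)
    ultimately show ?thesis
      using False by (intro indep_vars_iff_distr_eq_PiM'[THEN iffD2] meas) simp_all
  qed
  then show ?thesis
    unfolding iid_uniform_def using one by (auto cong: distr_cong)
qed

subsection \<open>Homomorphism densities of Borel kernels\<close>

text \<open>One real Borel kernel per edge. A Borel version of a symmetric function may lose
  symmetry on a null set, so \<open>p\<close> and \<open>q\<close> fix an orientation of every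
  edge.\<close>

locale edge_kernel =
  fixes E :: "'e set" and k :: nat and p q :: "'e \<Rightarrow> nat" and w :: "'e \<Rightarrow> real \<times> real \<Rightarrow> real"
  assumes finite_E: "finite E"
    and p: "e \<in> E \<Longrightarrow> p e \<in> {1..k}" and q: "e \<in> E \<Longrightarrow> q e \<in> {1..k}"
    and p_neq_q: "e \<in> E \<Longrightarrow> p e \<noteq> q e"
    and w_measurable: "e \<in> E \<Longrightarrow> w e \<in> borel_measurable borel"
    and w_moments: "e \<in> E \<Longrightarrow> integrable (uniform_measure lborel unit_square) (\<lambda>z. \<bar>w e z\<bar> ^ j)"
begin

text \<open>The value 0 on a collapsed edge is the decoration of pairs ii. It also keeps
  \<open>w e\<close> away from the diagonal, where almost everywhere statements and moment bounds
  say nothing.\<close>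

definition hom_term :: "(nat \<Rightarrow> nat) \<Rightarrow> (nat \<Rightarrow> real) \<Rightarrow> real" where
  "hom_term \<phi> x = (\<Prod>e\<in>E. if \<phi> (p e) = \<phi> (q e) then 0 else w e (x (\<phi> (p e)), x (\<phi> (q e))))"

definition hom_density :: real where
  "hom_density = (\<integral>x. hom_term (\<lambda>i. i) x \<partial>PiM {1..k} (\<lambda>_. uniform_unit))"

text \<open>A bound for the fourth moment of every \<open>hom_term\<close>, the same for all maps
  and all n. The exponent is the one in \<open>abs_prod_power_le\<close> for
  \<open>q = 4\<close>.\<close>

definition moment :: real where
  "moment = 1 + (\<Sum>e\<in>E. \<integral>z. \<bar>w e z\<bar> ^ (4 * card E) \<partial>uniform_measure lborel unit_square)"

text \<open>The last two premises ensure that the same edges collapse under both maps. They cover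
  both uses: restricting the sample under a fixed map, and relabelling an injective map to the
  identity.\<close>

lemma hom_term_cong:
  assumes "\<And>i. i \<in> {1..k} \<Longrightarrow> x (\<phi> i) = y (\<psi> i)" "inj_on \<phi> {1..k} \<longleftrightarrow> inj_on \<psi> {1..k}"
    and "\<phi> = \<psi> \<or> inj_on \<phi> {1..k}"
  shows "hom_term \<phi> x = hom_term \<psi> y"
proof -
  have "\<phi> (p e) = \<phi> (q e) \<longleftrightarrow> \<psi> (p e) = \<psi> (q e)" if "e \<in> E" for e
    using assms(2,3) p[OF that] q[OF that] by (auto dest: inj_onD)
  then show ?thesis
    unfolding hom_term_def using assms(1) p q by (intro prod.cong) auto
qed

text \<open>With \<open>A\<close> the image of \<phi>, this records that the term depends on no
  other sample points, which gives independence for maps with disjoint images.\<close>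

lemma hom_term_measurable:
  assumes "\<phi> \<in> {1..k} \<rightarrow> A"
  shows "hom_term \<phi> \<in> borel_measurable (PiM A (\<lambda>_. borel))"
  unfolding hom_term_def
proof (intro borel_measurable_prod)
  fix e assume e: "e \<in> E"
  have [measurable]: "(\<lambda>x. x (\<phi> (p e))) \<in> borel_measurable (PiM A (\<lambda>_. borel))"
    "(\<lambda>x. x (\<phi> (q e))) \<in> borel_measurable (PiM A (\<lambda>_. borel))"
    using assms p[OF e] q[OF e] by (auto intro!: measurable_component_singleton)
  note [measurable] = w_measurable[OF e]
  show "(\<lambda>x. if \<phi> (p e) = \<phi> (q e) then 0 else w e (x (\<phi> (p e)), x (\<phi> (q e))))
      \<in> borel_measurable (PiM A (\<lambda>_. borel))"
    by measurable
qed

end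

locale kernel_sample = uniform_sample M n X + edge_kernel E k p q w
  for M :: "'a measure" and n :: nat and X and E :: "'e set" and k p q w
begin

abbreviation sample :: "'a \<Rightarrow> nat \<Rightarrow> real" where
  "sample \<omega> \<equiv> \<lambda>i. X i \<omega>"

lemma hom_term_sample:
  assumes "\<phi> \<in> {1..k} \<rightarrow> A"
  shows "hom_term \<phi> (sample \<omega>) = hom_term \<phi> (\<lambda>i\<in>A. X i \<omega>)"
  using assms by (intro hom_term_cong) auto

lemma hom_term_sample_measurable:
  assumes "\<phi> \<in> {1..k} \<rightarrow> {1..n}"
  shows "(\<lambda>\<omega>. hom_term \<phi> (sample \<omega>)) \<in> borel_measurable M"
  unfolding hom_term_sample[OF assms]
  by (rule measurable_compose[OF _ hom_term_measurable[OF assms]]) (rule measurable_restrict, measurable)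

text \<open>\<open>abs_prod_power_le\<close> separates the edges, so their dependence is irrelevant:
  a collapsed edge contributes nothing, and the endpoints of any other edge are uniform on the
  square.\<close>

lemma
  assumes \<phi>: "\<phi> \<in> {1..k} \<rightarrow> {1..n}"
  shows integrable_hom_term4: "integrable M (\<lambda>\<omega>. hom_term \<phi> (sample \<omega>) ^ 4)"
    and hom_term4_le: "(\<integral>\<omega>. hom_term \<phi> (sample \<omega>) ^ 4 \<partial>M) \<le> moment"
proof -
  let ?U = "uniform_measure lborel unit_square"
  let ?y = "\<lambda>e \<omega>. if \<phi> (p e) = \<phi> (q e) then 0 else w e (X (\<phi> (p e)) \<omega>, X (\<phi> (q e)) \<omega>)"
  let ?m = "4 * card E"
  have y: "integrable M (\<lambda>\<omega>. \<bar>?y e \<omega>\<bar> ^ ?m)"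
    "(\<integral>\<omega>. \<bar>?y e \<omega>\<bar> ^ ?m \<partial>M) \<le> (\<integral>z. \<bar>w e z\<bar> ^ ?m \<partial>?U)" if e: "e \<in> E" for e
  proof -
    \<comment> \<open>A positive exponent makes the power of a collapsed factor 0 rather than
      1.\<close>
    have m: "?m > 0" using finite_E e by (auto simp: card_gt_0_iff)
    have "integrable M (\<lambda>\<omega>. \<bar>?y e \<omega>\<bar> ^ ?m)
      \<and> (\<integral>\<omega>. \<bar>?y e \<omega>\<bar> ^ ?m \<partial>M) \<le> (\<integral>z. \<bar>w e z\<bar> ^ ?m \<partial>?U)"
    proof (cases "\<phi> (p e) = \<phi> (q e)")
      case True
      then show ?thesis using m by (simp add: zero_power)
    next
      case False
      let ?i = "\<phi> (p e)" and ?j = "\<phi> (q e)"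
      have ij: "?i \<in> {1..n}" "?j \<in> {1..n}" using \<phi> p[OF e] q[OF e] by auto
      have [measurable]: "(\<lambda>\<omega>. (X ?i \<omega>, X ?j \<omega>)) \<in> borel_measurable M"
        using ij by measurable
      note [measurable] = w_measurable[OF e]
      note distr = distr_sample_pair[OF ij False]
      have "integrable (distr M borel (\<lambda>\<omega>. (X ?i \<omega>, X ?j \<omega>))) (\<lambda>z. \<bar>w e z\<bar> ^ ?m)"
        unfolding distr by (rule w_moments[OF e])
      then have "integrable M (\<lambda>\<omega>. \<bar>w e (X ?i \<omega>, X ?j \<omega>)\<bar> ^ ?m)"
        by (rule integrable_distr[rotated]) measurable
      moreover have "(\<integral>z. \<bar>w e z\<bar> ^ ?m \<partial>distr M borel (\<lambda>\<omega>. (X ?i \<omega>, X ?j \<omega>)))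
          = (\<integral>\<omega>. \<bar>w e (X ?i \<omega>, X ?j \<omega>)\<bar> ^ ?m \<partial>M)"
        by (rule integral_distr) measurable
      ultimately show ?thesis
        using False by (simp add: distr)
    qed
    then show "integrable M (\<lambda>\<omega>. \<bar>?y e \<omega>\<bar> ^ ?m)"
      "(\<integral>\<omega>. \<bar>?y e \<omega>\<bar> ^ ?m \<partial>M) \<le> (\<integral>z. \<bar>w e z\<bar> ^ ?m \<partial>?U)" by auto
  qed
  have g: "integrable M (\<lambda>\<omega>. 1 + (\<Sum>e\<in>E. \<bar>?y e \<omega>\<bar> ^ ?m))"
    by (intro Bochner_Integration.integrable_add Bochner_Integration.integrable_sum y) simp_all
  have le: "hom_term \<phi> (sample \<omega>) ^ 4 \<le> 1 + (\<Sum>e\<in>E. \<bar>?y e \<omega>\<bar> ^ ?m)" for \<omega>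
    using abs_prod_power_le[OF finite_E, of "\<lambda>e. ?y e \<omega>" 4] by (simp add: hom_term_def)
  note [measurable] = hom_term_sample_measurable[OF \<phi>]
  show i: "integrable M (\<lambda>\<omega>. hom_term \<phi> (sample \<omega>) ^ 4)"
    by (rule Bochner_Integration.integrable_bound[OF g])
      (auto intro!: AE_I2 order_trans[OF le])
  have "(\<integral>\<omega>. hom_term \<phi> (sample \<omega>) ^ 4 \<partial>M) \<le> (\<integral>\<omega>. 1 + (\<Sum>e\<in>E. \<bar>?y e \<omega>\<bar> ^ ?m) \<partial>M)"
    by (intro integral_mono i g le)
  also have "\<dots> = 1 + (\<Sum>e\<in>E. \<integral>\<omega>. \<bar>?y e \<omega>\<bar> ^ ?m \<partial>M)"
    by (subst Bochner_Integration.integral_add, simp, intro Bochner_Integration.integrable_sum y,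
      assumption, subst Bochner_Integration.integral_sum, rule y, assumption, simp add: prob_space)
  also have "\<dots> \<le> moment"
    unfolding moment_def by (intro add_left_mono sum_mono y)
  finally show "(\<integral>\<omega>. hom_term \<phi> (sample \<omega>) ^ 4 \<partial>M) \<le> moment" .
qed

lemma integral_hom_term:
  assumes \<phi>: "\<phi> \<in> {1..k} \<rightarrow> {1..n}" and inj: "inj_on \<phi> {1..k}"
  shows "(\<integral>\<omega>. hom_term \<phi> (sample \<omega>) \<partial>M) = hom_density"
proof (cases "k = 0")
  \<comment> \<open>The law of a tuple is available only for positive \<open>k\<close>. Without
    nodes there are no edges, and both integrals equal 1.\<close>
  case True
  then have "E = {}" using p by fastforce
  then have 1: "hom_term \<psi> x = 1" for \<psi> x
    unfolding hom_term_def by simp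
  interpret P: prob_space "PiM {1..k} (\<lambda>_. uniform_unit)"
    by (intro prob_space_PiM prob_space_uniform_unit)
  show ?thesis
    unfolding hom_density_def 1 using prob_space P.prob_space by (simp del: One_nat_def)
next
  case False
  have id: "hom_term (\<lambda>i. i) \<in> borel_measurable (PiM {1..k} (\<lambda>_. borel))"
    by (rule hom_term_measurable) auto
  have relabel: "hom_term (\<lambda>i. i) (\<lambda>i\<in>{1..k}. X (\<phi> i) \<omega>) = hom_term \<phi> (sample \<omega>)" for \<omega>
  proof (rule hom_term_cong)
    show "(\<lambda>i\<in>{1..k}. X (\<phi> i) \<omega>) i = sample \<omega> (\<phi> i)" if "i \<in> {1..k}" for i
      using that by (rule restrict_apply')
    show "inj_on (\<lambda>i. i) {1..k} \<longleftrightarrow> inj_on \<phi> {1..k}" "(\<lambda>i. i) = \<phi> \<or> inj_on (\<lambda>i. i) {1..k}"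
      using inj by simp_all
  qed
  have "hom_density = (\<integral>x. hom_term (\<lambda>i. i) x \<partial>distr M (PiM {1..k} (\<lambda>_. borel)) (\<lambda>\<omega>. \<lambda>i\<in>{1..k}. X (\<phi> i) \<omega>))"
    using False by (simp only: hom_density_def distr_sample_tuple[OF inj \<phi>])
  also have "\<dots> = (\<integral>\<omega>. hom_term (\<lambda>i. i) (\<lambda>i\<in>{1..k}. X (\<phi> i) \<omega>) \<partial>M)"
    using \<phi> by (intro integral_distr id measurable_restrict measurable_sample) auto
  also have "\<dots> = (\<integral>\<omega>. hom_term \<phi> (sample \<omega>) \<partial>M)"
    by (simp only: relabel)
  finally show ?thesis ..
qed

text \<open>This is Z_phi of the overview. The same constant is subtracted for every map, so the
  mean vanishes for injective maps but not in general.\<close>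

definition deviation :: "(nat \<Rightarrow> nat) \<Rightarrow> 'a \<Rightarrow> real" where
  "deviation \<phi> \<omega> = hom_term \<phi> (sample \<omega>) - hom_density"

lemma deviation_measurable:
  "\<phi> \<in> {1..k} \<rightarrow> {1..n} \<Longrightarrow> deviation \<phi> \<in> borel_measurable M"
  unfolding deviation_def [abs_def] using hom_term_sample_measurable by simp

lemma
  assumes \<phi>: "\<phi> \<in> {1..k} \<rightarrow> {1..n}"
  shows integrable_deviation4: "integrable M (\<lambda>\<omega>. deviation \<phi> \<omega> ^ 4)"
    and deviation4_le: "(\<integral>\<omega>. deviation \<phi> \<omega> ^ 4 \<partial>M) \<le> 8 * (moment + hom_density ^ 4)"
proof -
  note [measurable] = deviation_measurable[OF \<phi>]
  have le: "deviation \<phi> \<omega> ^ 4 \<le> 8 * (hom_term \<phi> (sample \<omega>) ^ 4 + hom_density ^ 4)" for \<omega>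
    using power4_add_le[of "hom_term \<phi> (sample \<omega>)" "- hom_density"] by (simp add: deviation_def)
  have g: "integrable M (\<lambda>\<omega>. 8 * (hom_term \<phi> (sample \<omega>) ^ 4 + hom_density ^ 4))"
    using integrable_hom_term4[OF \<phi>] by simp
  show i: "integrable M (\<lambda>\<omega>. deviation \<phi> \<omega> ^ 4)"
    by (rule Bochner_Integration.integrable_bound[OF g])
      (auto intro!: AE_I2 order_trans[OF le])
  have "(\<integral>\<omega>. deviation \<phi> \<omega> ^ 4 \<partial>M) \<le> (\<integral>\<omega>. 8 * (hom_term \<phi> (sample \<omega>) ^ 4 + hom_density ^ 4) \<partial>M)"
    by (intro integral_mono i g le)
  also have "\<dots> \<le> 8 * (moment + hom_density ^ 4)"
    using hom_term4_le[OF \<phi>] integrable_hom_term4[OF \<phi>] by (simp add: prob_space)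
  finally show "(\<integral>\<omega>. deviation \<phi> \<omega> ^ 4 \<partial>M) \<le> 8 * (moment + hom_density ^ 4)" .
qed

lemma integrable_deviation:
  assumes \<phi>: "\<phi> \<in> {1..k} \<rightarrow> {1..n}"
  shows "integrable M (deviation \<phi>)"
proof (rule Bochner_Integration.integrable_bound)
  show "integrable M (\<lambda>\<omega>. 1 + deviation \<phi> \<omega> ^ 4)"
    using integrable_deviation4[OF \<phi>] by simp
  have "\<bar>x\<bar> \<le> 1 + x ^ 4" for x :: real
  proof (cases "\<bar>x\<bar> \<le> 1")
    case False
    then have "\<bar>x\<bar> ^ 1 \<le> \<bar>x\<bar> ^ 4" by (intro power_increasing) auto
    then show ?thesis by simp
  qed (simp add: add_increasing2)
  then show "AE \<omega> in M. norm (deviation \<phi> \<omega>) \<le> norm (1 + deviation \<phi> \<omega> ^ 4)"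
    by (auto intro!: AE_I2 order_trans[OF _ abs_ge_self])
qed (rule deviation_measurable[OF \<phi>])

text \<open>The first factor depends on other sample points than the remaining three, so the
  expectation factorizes, and injectivity of \<phi> makes the first mean zero. The other three maps
  may overlap and need not be injective.\<close>

lemma integral_deviation_mult_disjoint:
  assumes maps: "\<phi> \<in> {1..k} \<rightarrow> {1..n}" "\<psi>1 \<in> {1..k} \<rightarrow> {1..n}" "\<psi>2 \<in> {1..k} \<rightarrow> {1..n}" "\<psi>3 \<in> {1..k} \<rightarrow> {1..n}"
    and inj: "inj_on \<phi> {1..k}"
    and disj: "\<phi> ` {1..k} \<inter> (\<psi>1 ` {1..k} \<union> \<psi>2 ` {1..k} \<union> \<psi>3 ` {1..k}) = {}"
  shows "(\<integral>\<omega>. deviation \<phi> \<omega> * (deviation \<psi>1 \<omega> * deviation \<psi>2 \<omega> * deviation \<psi>3 \<omega>) \<partial>M) = 0"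
proof -
  let ?A = "\<phi> ` {1..k}" and ?B = "\<psi>1 ` {1..k} \<union> \<psi>2 ` {1..k} \<union> \<psi>3 ` {1..k}"
  let ?d = "\<lambda>\<psi> x. hom_term \<psi> x - hom_density"
  let ?D = "\<lambda>\<omega>. deviation \<psi>1 \<omega> * deviation \<psi>2 \<omega> * deviation \<psi>3 \<omega>"
  have sub: "?A \<subseteq> {1..n}" "?B \<subseteq> {1..n}" using maps by auto
  have [measurable]: "hom_term \<phi> \<in> borel_measurable (PiM ?A (\<lambda>_. borel))"
    by (rule hom_term_measurable) auto
  have [measurable]: "hom_term \<psi> \<in> borel_measurable (PiM ?B (\<lambda>_. borel))"
    if "\<psi> \<in> {\<psi>1, \<psi>2, \<psi>3}" for \<psi>
    using that by (intro hom_term_measurable) auto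
  have dA: "deviation \<phi> = (\<lambda>\<omega>. ?d \<phi> (\<lambda>i\<in>?A. X i \<omega>))"
    unfolding deviation_def [abs_def] by (intro ext arg_cong2[where f = minus] hom_term_sample) auto
  have dB: "deviation \<psi> = (\<lambda>\<omega>. ?d \<psi> (\<lambda>i\<in>?B. X i \<omega>))" if "\<psi> \<in> {\<psi>1, \<psi>2, \<psi>3}" for \<psi>
    unfolding deviation_def [abs_def]
    using that by (intro ext arg_cong2[where f = minus] hom_term_sample) auto
  have "indep_var borel (\<lambda>\<omega>. ?d \<phi> (\<lambda>i\<in>?A. X i \<omega>))
    borel (\<lambda>\<omega>. (\<lambda>x. ?d \<psi>1 x * ?d \<psi>2 x * ?d \<psi>3 x) (\<lambda>i\<in>?B. X i \<omega>))"
    by (rule indep_disjoint[OF sub disj]) measurable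
  then have indep: "indep_var borel (deviation \<phi>) borel ?D"
    unfolding dA using dB by simp
  \<comment> \<open>The dominating function of \<open>mult4_le_power4\<close> with 1 as the missing
    fourth factor.\<close>
  have "integrable M (\<lambda>\<omega>. (1 + deviation \<psi>1 \<omega> ^ 4 + deviation \<psi>2 \<omega> ^ 4 + deviation \<psi>3 \<omega> ^ 4) / 4)"
    using maps by (intro integrable_divide Bochner_Integration.integrable_add integrable_deviation4) simp_all
  then have "integrable M ?D"
  proof (rule Bochner_Integration.integrable_bound)
    show "?D \<in> borel_measurable M"
      using maps by (intro borel_measurable_times deviation_measurable)
    show "AE \<omega> in M. norm (?D \<omega>)
        \<le> norm ((1 + deviation \<psi>1 \<omega> ^ 4 + deviation \<psi>2 \<omega> ^ 4 + deviation \<psi>3 \<omega> ^ 4) / 4)"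
    proof (rule AE_I2)
      fix \<omega>
      show "norm (?D \<omega>)
        \<le> norm ((1 + deviation \<psi>1 \<omega> ^ 4 + deviation \<psi>2 \<omega> ^ 4 + deviation \<psi>3 \<omega> ^ 4) / 4)"
        using mult4_le_power4[of 1 "deviation \<psi>1 \<omega>" "deviation \<psi>2 \<omega>" "deviation \<psi>3 \<omega>"]
        by simp
    qed
  qed
  from indep_var_lebesgue_integral[OF indep integrable_deviation[OF maps(1)] this]
  have "(\<integral>\<omega>. deviation \<phi> \<omega> * ?D \<omega> \<partial>M) = (\<integral>\<omega>. deviation \<phi> \<omega> \<partial>M) * (\<integral>\<omega>. ?D \<omega> \<partial>M)" .
  moreover have "(\<integral>\<omega>. deviation \<phi> \<omega> \<partial>M) = 0"
  proof -
    have "integrable M (\<lambda>\<omega>. deviation \<phi> \<omega> + hom_density)"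
      using integrable_deviation[OF maps(1)] by simp
    then have "integrable M (\<lambda>\<omega>. hom_term \<phi> (sample \<omega>))"
      by (simp add: deviation_def)
    then show ?thesis
      using integral_hom_term[OF maps(1) inj] by (simp add: deviation_def prob_space)
  qed
  ultimately show ?thesis by simp
qed

text \<open>The constant 448 is 8 * 7 * 8: splitting into injective and non-injective maps, the
  fourth moment bound for a sum, and the bound for a single deviation. The powers of
  \<open>k\<close> come from \<open>D\<^sup>2\<close> and \<open>(D * D)\<^sup>2\<close>.\<close>

lemma
  assumes n: "n > 0"
  defines "S \<equiv> \<lambda>\<omega>. (\<Sum>\<phi>\<in>{1..k} \<rightarrow>\<^sub>E {1..n}. hom_term \<phi> (sample \<omega>)) / real n ^ k - hom_density"
  shows integrable_sample_density4: "integrable M (\<lambda>\<omega>. S \<omega> ^ 4)"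
    and sample_density4_le:
      "(\<integral>\<omega>. S \<omega> ^ 4 \<partial>M) \<le> 448 * (moment + hom_density ^ 4) * (real k ^ 4 + real k ^ 8) / (real n)\<^sup>2"
proof -
  define C where "C = 8 * (moment + hom_density ^ 4)"
  define I where "I = {\<phi> \<in> {1..k} \<rightarrow>\<^sub>E {1..n}. inj_on \<phi> {1..k}}"
  define J where "J = {\<phi> \<in> {1..k} \<rightarrow>\<^sub>E {1..n}. \<not> inj_on \<phi> {1..k}}"
  have fin: "finite ({1..k} \<rightarrow>\<^sub>E {1..n})" by (auto intro!: finite_PiE)
  have IJ: "finite I" "finite J" "I \<inter> J = {}" "I \<union> J = {1..k} \<rightarrow>\<^sub>E {1..n}"
    unfolding I_def J_def using fin by auto
  have IJ_maps: "\<phi> \<in> {1..k} \<rightarrow> {1..n}" if "\<phi> \<in> I \<union> J" for \<phi>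
    using that unfolding I_def J_def by auto
  \<comment> \<open>One number serves twice: it bounds how many injective maps meet a given image,
    and how many maps are not injective.\<close>
  define D where "D = (real k)\<^sup>2 * real n ^ (k - 1)"
  let ?SI = "\<lambda>\<omega>. (\<Sum>\<phi>\<in>I. deviation \<phi> \<omega>)" and ?SJ = "\<lambda>\<omega>. (\<Sum>\<phi>\<in>J. deviation \<phi> \<omega>)"
  have "0 \<le> (\<integral>z. \<bar>w e z\<bar> ^ (4 * card E) \<partial>uniform_measure lborel unit_square)" for e
    by (rule Bochner_Integration.integral_nonneg) simp
  then have C: "0 \<le> C"
    unfolding C_def moment_def by (intro mult_nonneg_nonneg add_nonneg_nonneg sum_nonneg) auto
  have cI: "real (card I) \<le> real n ^ k"
  proof -
    have "card I \<le> card ({1..k} \<rightarrow>\<^sub>E {1..n})"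
      using fin by (intro card_mono) (auto simp: I_def)
    then show ?thesis by (simp add: card_PiE flip: of_nat_power)
  qed
  have cJ: "real (card J) \<le> D"
  proof -
    have "card J \<le> k\<^sup>2 * n ^ (k - 1)"
      using card_PiE_not_inj_le[of "{1..k}" "{1..n}"] by (simp add: J_def)
    from of_nat_mono[OF this, where 'a = real] show ?thesis by (simp add: D_def)
  qed
  have moments: "deviation \<phi> \<in> borel_measurable M" "integrable M (\<lambda>\<omega>. deviation \<phi> \<omega> ^ 4)"
    "(\<integral>\<omega>. deviation \<phi> \<omega> ^ 4 \<partial>M) \<le> C" if "\<phi> \<in> I \<union> J" for \<phi>
    using IJ_maps[OF that] unfolding C_def
    by (rule deviation_measurable integrable_deviation4 deviation4_le)+
  let ?R = "\<lambda>\<phi> \<psi>. \<phi> ` {1..k} \<inter> \<psi> ` {1..k} \<noteq> {}"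
  have deg: "real (card {\<psi>\<in>I. ?R \<phi> \<psi>}) \<le> D" for \<phi>
  proof -
    have "card {\<psi>\<in>I. ?R \<phi> \<psi>} \<le> card {\<psi> \<in> {1..k} \<rightarrow>\<^sub>E {1..n}. ?R \<phi> \<psi>}"
      by (rule card_mono) (use fin in \<open>auto simp: I_def\<close>)
    also have "\<dots> \<le> k\<^sup>2 * n ^ (k - 1)"
      using card_PiE_meet_le[of "{1..k}" "{1..n}" \<phi>] by simp
    finally have "card {\<psi>\<in>I. ?R \<phi> \<psi>} \<le> k\<^sup>2 * n ^ (k - 1)" .
    from of_nat_mono[OF this, where 'a = real] show ?thesis by (simp add: D_def)
  qed
  have orth: "(\<integral>\<omega>. deviation a \<omega> * (deviation b \<omega> * deviation c \<omega> * deviation d \<omega>) \<partial>M) = 0"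
    if "{a, b, c, d} \<subseteq> I" "\<not> ?R a b" "\<not> ?R a c" "\<not> ?R a d" for a b c d
  proof (rule integral_deviation_mult_disjoint)
    show "inj_on a {1..k}" using that(1) by (auto simp: I_def)
    show "a ` {1..k} \<inter> (b ` {1..k} \<union> c ` {1..k} \<union> d ` {1..k}) = {}"
      using that(2-4) by blast
  qed (use that(1) IJ_maps in blast)+
  have "integrable M (\<lambda>\<omega>. ?SI \<omega> ^ 4) \<and> (\<integral>\<omega>. ?SI \<omega> ^ 4 \<partial>M) \<le> 7 * C * (real (card I) * D)\<^sup>2"
    by (intro conjI fourth_moment_sum_le[where R = ?R] orth)
      (auto simp del: One_nat_def intro: IJ(1) moments deg)
  then have intI: "integrable M (\<lambda>\<omega>. ?SI \<omega> ^ 4)"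
    and leI: "(\<integral>\<omega>. ?SI \<omega> ^ 4 \<partial>M) \<le> 7 * C * (real (card I) * D)\<^sup>2" by auto
  note leI
  also have "7 * C * (real (card I) * D)\<^sup>2 \<le> 7 * C * (real n ^ k * D)\<^sup>2"
    using C cI by (intro mult_left_mono power_mono mult_right_mono) (auto simp: D_def)
  finally have leI: "(\<integral>\<omega>. ?SI \<omega> ^ 4 \<partial>M) \<le> 7 * C * (real n ^ k * D)\<^sup>2" .
  \<comment> \<open>With a relation that always holds, the orthogonality premise is vacuous. The
    crude bound suffices because there are at most \<open>D\<close> such maps.\<close>
  have "integrable M (\<lambda>\<omega>. ?SJ \<omega> ^ 4) \<and> (\<integral>\<omega>. ?SJ \<omega> ^ 4 \<partial>M) \<le> 7 * C * (real (card J) * D)\<^sup>2"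
    by (intro conjI fourth_moment_sum_le[where R = "\<lambda>_ _. True"])
      (auto intro: IJ(2) cJ moments)
  then have intJ: "integrable M (\<lambda>\<omega>. ?SJ \<omega> ^ 4)"
    and leJ: "(\<integral>\<omega>. ?SJ \<omega> ^ 4 \<partial>M) \<le> 7 * C * (real (card J) * D)\<^sup>2" by auto
  note leJ
  also have "7 * C * (real (card J) * D)\<^sup>2 \<le> 7 * C * (D * D)\<^sup>2"
    using C cJ by (intro mult_left_mono power_mono mult_right_mono) (auto simp: D_def)
  finally have leJ: "(\<integral>\<omega>. ?SJ \<omega> ^ 4 \<partial>M) \<le> 7 * C * (D * D)\<^sup>2" .
  let ?N = "real n ^ k"
  have N: "?N > 0" using n by simp
  have S_eq: "S \<omega> = (?SI \<omega> + ?SJ \<omega>) / ?N" for \<omega>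
  proof -
    have "?SI \<omega> + ?SJ \<omega> = (\<Sum>\<phi>\<in>{1..k} \<rightarrow>\<^sub>E {1..n}. deviation \<phi> \<omega>)"
      using sum.union_disjoint[OF IJ(1-3), of "\<lambda>\<phi>. deviation \<phi> \<omega>"] IJ(4) by simp
    also have "\<dots> = (\<Sum>\<phi>\<in>{1..k} \<rightarrow>\<^sub>E {1..n}. hom_term \<phi> (sample \<omega>)) - ?N * hom_density"
      by (simp add: deviation_def sum_subtractf card_PiE)
    finally show ?thesis using N by (simp add: S_def field_simps)
  qed
  have [measurable]: "deviation \<phi> \<in> borel_measurable M" if "\<phi> \<in> I \<union> J" for \<phi>
    using IJ_maps[OF that] by (rule deviation_measurable)
  have S_meas: "S \<in> borel_measurable M"
    unfolding S_eq[abs_def] by (intro borel_measurable_divide borel_measurable_add borel_measurable_sum) auto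
  have le: "S \<omega> ^ 4 \<le> 8 * (?SI \<omega> ^ 4 + ?SJ \<omega> ^ 4) / ?N ^ 4" for \<omega>
    unfolding S_eq power_divide by (intro divide_right_mono power4_add_le) simp
  have g: "integrable M (\<lambda>\<omega>. 8 * (?SI \<omega> ^ 4 + ?SJ \<omega> ^ 4) / ?N ^ 4)"
    by (intro integrable_divide integrable_mult_right Bochner_Integration.integrable_add intI intJ)
  show i: "integrable M (\<lambda>\<omega>. S \<omega> ^ 4)"
  proof (rule Bochner_Integration.integrable_bound[OF g])
    show "(\<lambda>\<omega>. S \<omega> ^ 4) \<in> borel_measurable M"
      using S_meas by (rule borel_measurable_power)
    show "AE \<omega> in M. norm (S \<omega> ^ 4) \<le> norm (8 * (?SI \<omega> ^ 4 + ?SJ \<omega> ^ 4) / ?N ^ 4)"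
      using le by (intro AE_I2) (simp add: order_trans[OF _ abs_ge_self])
  qed
  \<comment> \<open>For \<open>k = 0\<close> the truncated exponent \<open>k - 1\<close> would spoil
    the estimate, but then the factor \<open>(real k)\<^sup>2\<close> makes \<open>D\<close>
    zero.\<close>
  have D: "D * n \<le> (real k)\<^sup>2 * ?N"
  proof (cases "k = 0")
    case False
    then have "real n ^ (k - 1) * real n = ?N"
      by (cases k) auto
    then show ?thesis by (simp add: D_def mult.assoc)
  qed (simp add: D_def)
  have D0: "0 \<le> D" by (simp add: D_def)
  have n2: "1 \<le> (real n)\<^sup>2" using n by simp
  have D2: "D\<^sup>2 * (real n)\<^sup>2 \<le> (real k) ^ 4 * ?N\<^sup>2"
    using power_mono[OF D, of 2] D0 by (simp add: power_mult_distrib flip: power_mult)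
  \<comment> \<open>The non-injective part is of order n^(-4). A factor n^2 is given away to reach
    the same denominator as the injective part.\<close>
  have D4: "(D * D)\<^sup>2 * (real n)\<^sup>2 \<le> (real k) ^ 8 * ?N ^ 4"
  proof -
    have "(D * D)\<^sup>2 * (real n)\<^sup>2 * 1 \<le> (D * D)\<^sup>2 * (real n)\<^sup>2 * (real n)\<^sup>2"
      using n2 by (intro mult_left_mono) auto
    also have "\<dots> = (D * n) ^ 4"
      by (simp add: power_mult_distrib flip: power_mult power_add power2_eq_square)
    also have "\<dots> \<le> ((real k)\<^sup>2 * ?N) ^ 4"
      using D0 by (intro power_mono D) simp
    finally show ?thesis by (simp add: power_mult_distrib flip: power_mult)
  qed
  have "(\<integral>\<omega>. S \<omega> ^ 4 \<partial>M) \<le> (\<integral>\<omega>. 8 * (?SI \<omega> ^ 4 + ?SJ \<omega> ^ 4) / ?N ^ 4 \<partial>M)"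
    by (intro integral_mono i g le)
  also have "\<dots> = 8 * ((\<integral>\<omega>. ?SI \<omega> ^ 4 \<partial>M) + (\<integral>\<omega>. ?SJ \<omega> ^ 4 \<partial>M)) / ?N ^ 4"
    by (simp add: intI intJ)
  also have "\<dots> \<le> 8 * (7 * C * (?N * D)\<^sup>2 + 7 * C * (D * D)\<^sup>2) / ?N ^ 4"
    by (intro divide_right_mono mult_left_mono add_mono leI leJ) auto
  also have "\<dots> = 56 * C * (?N\<^sup>2 * (D\<^sup>2 * (real n)\<^sup>2) + (D * D)\<^sup>2 * (real n)\<^sup>2) / (?N ^ 4 * (real n)\<^sup>2)"
    using n by (simp add: field_simps power_mult_distrib)
  also have "\<dots> \<le> 56 * C * (?N\<^sup>2 * ((real k) ^ 4 * ?N\<^sup>2) + (real k) ^ 8 * ?N ^ 4) / (?N ^ 4 * (real n)\<^sup>2)"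
    using C by (intro divide_right_mono mult_left_mono add_mono D2 D4) auto
  also have "\<dots> = 56 * C * (real k ^ 4 + real k ^ 8) / (real n)\<^sup>2"
  proof -
    have "?N\<^sup>2 * ((real k) ^ 4 * ?N\<^sup>2) + (real k) ^ 8 * ?N ^ 4 = ?N ^ 4 * (real k ^ 4 + real k ^ 8)"
      by (simp add: algebra_simps flip: power_mult power_add)
    then show ?thesis using N by simp
  qed
  finally show "(\<integral>\<omega>. S \<omega> ^ 4 \<partial>M)
      \<le> 448 * (moment + hom_density ^ 4) * (real k ^ 4 + real k ^ 8) / (real n)\<^sup>2"
    by (simp add: C_def)
qed

end

subsection \<open>Graphons\<close>

text \<open>In a complete measure, a function equal almost everywhere to a measurable one is
  measurable. This supplies the measurability of the integrand in
  \<open>density_graphon\<close>.\<close>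

lemma integral_completion_cong_AE:
  fixes f g :: "'a \<Rightarrow> real"
  assumes g: "g \<in> borel_measurable M" and ae: "AE x in M. f x = g x"
  shows "(\<integral>x. f x \<partial>completion M) = (\<integral>x. g x \<partial>M)"
proof -
  have ae': "AE x in completion M. f x = g x"
    using ae by (rule AE_completion)
  have g': "g \<in> borel_measurable (completion M)"
    using g by (rule measurable_completion)
  have "f \<in> borel_measurable (completion M)"
  proof (rule measurableI)
    fix A :: "real set" assume A: "A \<in> sets borel"
    show "f -` A \<inter> space (completion M) \<in> sets (completion M)"
    proof (rule completion.in_sets_AE)
      show "g -` A \<inter> space (completion M) \<in> sets (completion M)"
        using g' A by (rule measurable_sets)
      show "AE x in completion M. x \<in> g -` A \<inter> space (completion M)
          \<longleftrightarrow> x \<in> f -` A \<inter> space (completion M)"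
        using ae' by eventually_elim simp
    qed auto
  qed simp
  then have "(\<integral>x. f x \<partial>completion M) = (\<integral>x. g x \<partial>completion M)"
    using g' ae' by (rule integral_cong_AE)
  then show ?thesis
    using integral_completion[OF g] by simp
qed

lemma borel_version_on:
  fixes h :: "'a::euclidean_space \<Rightarrow> real"
  assumes "h \<in> borel_measurable (lebesgue_on S)" "S \<in> sets lebesgue"
  obtains w where "w \<in> borel_measurable borel" "AE z in lborel. z \<in> S \<longrightarrow> w z = h z"
proof -
  have "(\<lambda>z. if z \<in> S then h z else 0) \<in> borel_measurable lebesgue"
    using assms by (rule borel_measurable_if_I)
  then obtain w where w: "w \<in> borel_measurable lborel" "AE z in lborel. (if z \<in> S then h z else 0) = w z"
    using completion_ex_borel_measurable_real by blast
  from w(2) have "AE z in lborel. z \<in> S \<longrightarrow> w z = h z"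
    by eventually_elim (auto split: if_splits)
  with w(1) that show ?thesis by simp
qed

lemma emeasure_unit_square: "emeasure lborel unit_square = 1"
  using lborel.emeasure_pair_measure_Times[of "{0..1::real}" lborel "{0..1::real}"]
  by (simp add: lborel_prod)

lemma dual_graphon_moment_finite:
  assumes "dual_graphon W"
  shows "(\<integral>\<^sup>+z\<in>unit_square. ennreal (norm (W (fst z) (snd z)) ^ j) \<partial>lborel) < \<infinity>"
\<comment> \<open>The integrability assumption starts at p = 1; for \<open>j = 0\<close> the
  integral is the area of the square.\<close>
proof (cases "j = 0")
  case True
  then show ?thesis
    using unit_square_borel by (simp add: nn_integral_indicator emeasure_unit_square)
next
  case False
  then have "in_Lp (real j) (lebesgue_on unit_square) (\<lambda>(x, y). norm (W x y))"
    using assms by (auto simp: dual_graphon_def)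
  then have "integrable (lebesgue_on unit_square) (\<lambda>z. \<bar>norm (W (fst z) (snd z))\<bar> powr real j)"
    by (simp add: in_Lp_def case_prod_unfold)
  moreover have "\<bar>norm (W (fst z) (snd z))\<bar> powr real j = norm (W (fst z) (snd z)) ^ j" for z
    using False by (cases "norm (W (fst z) (snd z)) = 0") (auto simp: powr_realpow zero_power)
  ultimately have "integrable (lebesgue_on unit_square) (\<lambda>z. norm (W (fst z) (snd z)) ^ j)"
    by (simp only:)
  then have "(\<integral>\<^sup>+z. ennreal (norm (W (fst z) (snd z)) ^ j) \<partial>lebesgue_on unit_square) < \<infinity>"
    by (auto simp: integrable_iff_bounded)
  then show ?thesis
    using unit_square_borel by (simp add: nn_integral_restrict_space nn_integral_completion)
qed

text \<open>Each edge pairs the graphon with one fixed vector, so weak-* measurability yields a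
  Borel version for it. Its moments are bounded by those of the norm, since the pairing is at most
  the product of the norms.\<close>

lemma dual_graphon_edge_kernel:
  assumes W: "dual_graphon W" and F: "simple_decorated_graph F"
  obtains w where "edge_kernel (edge_set F) (num_nodes F) Min Max w"
    and "\<And>e. AE z in lborel. z \<in> unit_square \<longrightarrow> w e z = blinfun_apply (W (fst z) (snd z)) (edge_dec F e)"
proof -
  have S: "unit_square \<in> sets lebesgue"
    using unit_square_borel by simp
  have "\<exists>w. w \<in> borel_measurable borel \<and>
      (AE z in lborel. z \<in> unit_square \<longrightarrow> w z = blinfun_apply (W (fst z) (snd z)) (edge_dec F e))" for e
  proof -
    have "(\<lambda>z. blinfun_apply (W (fst z) (snd z)) (edge_dec F e)) \<in> borel_measurable (lebesgue_on unit_square)"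
      using W by (simp add: dual_graphon_def weak_star_measurable_def case_prod_unfold)
    then show ?thesis by (rule borel_version_on[OF _ S]) blast
  qed
  then have "\<exists>w. \<forall>e. w e \<in> borel_measurable borel \<and> (AE z in lborel. z \<in> unit_square
      \<longrightarrow> w e z = blinfun_apply (W (fst z) (snd z)) (edge_dec F e))"
    by (intro choice allI)
  then obtain w where w: "\<And>e. w e \<in> borel_measurable borel"
    and w_eq: "\<And>e. AE z in lborel. z \<in> unit_square
      \<longrightarrow> w e z = blinfun_apply (W (fst z) (snd z)) (edge_dec F e)"
    by blast
  have "edge_kernel (edge_set F) (num_nodes F) Min Max w"
  proof
    show "finite (edge_set F)"
    proof (rule finite_subset)
      show "edge_set F \<subseteq> Pow {1..num_nodes F}"
        using F by (auto simp: simple_decorated_graph_def)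
    qed simp
  next
    fix e assume "e \<in> edge_set F"
    then have e: "e \<subseteq> {1..num_nodes F}" "card e = 2"
      using F by (auto simp: simple_decorated_graph_def)
    then obtain a b where ab: "e = {a, b}" "a \<noteq> b"
      by (meson card_2_iff)
    then have "Min e \<in> e" "Max e \<in> e" "Min e \<noteq> Max e"
      by (auto simp: min_def max_def)
    with e show "Min e \<in> {1..num_nodes F}" "Max e \<in> {1..num_nodes F}" "Min e \<noteq> Max e"
      by auto
  next
    show "w e \<in> borel_measurable borel" for e by (rule w)
  next
    fix e j
    let ?c = "norm (edge_dec F e)"
    note [measurable] = w[of e]
    show "integrable (uniform_measure lborel unit_square) (\<lambda>z. \<bar>w e z\<bar> ^ j)"
    proof (rule integrableI_bounded)
      have "(\<integral>\<^sup>+z. ennreal (norm (\<bar>w e z\<bar> ^ j)) \<partial>uniform_measure lborel unit_square)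
          = (\<integral>\<^sup>+z\<in>unit_square. ennreal (\<bar>w e z\<bar> ^ j) \<partial>lborel)"
        using unit_square_borel
        by (subst nn_integral_uniform_measure) (auto simp: emeasure_unit_square divide_ennreal_def)
      also have "\<dots> \<le> (\<integral>\<^sup>+z. ennreal (?c ^ j)
          * (ennreal (norm (W (fst z) (snd z)) ^ j) * indicator unit_square z) \<partial>lborel)"
      proof (rule nn_integral_mono_AE)
        show "AE z in lborel. ennreal (\<bar>w e z\<bar> ^ j) * indicator unit_square z
          \<le> ennreal (?c ^ j) * (ennreal (norm (W (fst z) (snd z)) ^ j) * indicator unit_square z)"
          using w_eq[of e]
        proof eventually_elim
          fix z assume z: "z \<in> unit_square \<longrightarrow> w e z = blinfun_apply (W (fst z) (snd z)) (edge_dec F e)"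
          show "ennreal (\<bar>w e z\<bar> ^ j) * indicator unit_square z
            \<le> ennreal (?c ^ j) * (ennreal (norm (W (fst z) (snd z)) ^ j) * indicator unit_square z)"
          proof (cases "z \<in> unit_square")
            case True
            then have "\<bar>w e z\<bar> \<le> norm (W (fst z) (snd z)) * ?c"
              using z norm_blinfun[of "W (fst z) (snd z)" "edge_dec F e"] by simp
            then have "\<bar>w e z\<bar> ^ j \<le> (norm (W (fst z) (snd z)) * ?c) ^ j"
              by (intro power_mono) auto
            then have "\<bar>w e z\<bar> ^ j \<le> ?c ^ j * norm (W (fst z) (snd z)) ^ j"
              by (simp add: power_mult_distrib mult.commute)
            then show ?thesis
              using True by (simp flip: ennreal_mult)
          qed simp
        qed
      qed
      \<comment> \<open>The constant is pulled out over \<open>lebesgue\<close> because the norm of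
        the graphon is measurable there and need not be Borel.\<close>
      also have "\<dots> = (\<integral>\<^sup>+z. ennreal (?c ^ j)
          * (ennreal (norm (W (fst z) (snd z)) ^ j) * indicator unit_square z) \<partial>lebesgue)"
        by (simp add: nn_integral_completion)
      also have "\<dots> = ennreal (?c ^ j)
          * (\<integral>\<^sup>+z\<in>unit_square. ennreal (norm (W (fst z) (snd z)) ^ j) \<partial>lebesgue)"
      proof (rule nn_integral_cmult)
        have "(\<lambda>z. norm (W (fst z) (snd z))) \<in> borel_measurable (lebesgue_on unit_square)"
          using W by (auto simp: dual_graphon_def in_Lp_def case_prod_unfold)
        then have "(\<lambda>z. ennreal (norm (W (fst z) (snd z)) ^ j)) \<in> borel_measurable (lebesgue_on unit_square)"
          by measurable
        then show "(\<lambda>z. ennreal (norm (W (fst z) (snd z)) ^ j) * indicator unit_square z) \<in> borel_measurable lebesgue"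
          using S by (subst (asm) borel_measurable_restrict_space_iff_ennreal) auto
      qed
      also have "\<dots> < \<infinity>"
        using dual_graphon_moment_finite[OF W, of j]
        by (simp add: nn_integral_completion ennreal_mult_less_top)
      finally show "(\<integral>\<^sup>+z. ennreal (norm (\<bar>w e z\<bar> ^ j)) \<partial>uniform_measure lborel unit_square) < \<infinity>" .
    qed simp
  qed
  with w_eq that show ?thesis by blast
qed

theorem theorem3p8:
  fixes W :: "real \<Rightarrow> real \<Rightarrow> 'b::banach \<Rightarrow>\<^sub>L real"
    and F :: "'b decorated_graph"
    and M :: "'a measure"
    and X :: "nat \<Rightarrow> nat \<Rightarrow> 'a \<Rightarrow> real"
  assumes "separable_space (euclidean :: 'b topology)"
    and "dual_graphon W"
    and "simple_decorated_graph F"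
    and "prob_space M"
    and "\<And>n. iid_uniform M n (X n)"
  shows "AE \<omega> in M. (\<lambda>n. density_graph F (sampled_graph n W (\<lambda>i. X n i \<omega>)))
           \<longlonglongrightarrow> density_graphon F W"
proof -
  let ?k = "num_nodes F" and ?E = "edge_set F"
  obtain w where kernel: "edge_kernel ?E ?k Min Max w"
    and w: "\<And>e. AE z in lborel. z \<in> unit_square
      \<longrightarrow> w e z = blinfun_apply (W (fst z) (snd z)) (edge_dec F e)"
    using dual_graphon_edge_kernel[OF assms(2,3)] by blast
  interpret K: edge_kernel ?E ?k Min Max w by (rule kernel)

  \<comment> \<open>The limit is identified on the cube itself, with the coordinates as sample and
    the identity as map.\<close>
  let ?Q = "\<Pi>\<^sub>M i\<in>{1..?k}. restrict_space lborel {0..1::real}"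
  have "prob_space ?Q"
    by (intro prob_space_PiM prob_space_restrict_space) simp_all
  then have Q: "uniform_sample ?Q ?k (\<lambda>i x. x i)"
    using iid_uniform_coordinates by (simp only: uniform_sample_def uniform_sample_axioms_def)
  have Q': "kernel_sample ?Q ?k (\<lambda>i x. x i) ?E ?k Min Max w"
    unfolding kernel_sample_def using Q kernel by (rule conjI)
  have "AE x in ?Q. \<forall>e\<in>?E. w e (x (Min e), x (Max e))
      = blinfun_apply (W (x (Min e)) (x (Max e))) (edge_dec F e)"
  proof (rule AE_finite_allI[OF K.finite_E])
    fix e assume e: "e \<in> ?E"
    show "AE x in ?Q. w e (x (Min e), x (Max e))
      = blinfun_apply (W (x (Min e)) (x (Max e))) (edge_dec F e)"
      by (rule uniform_sample.AE_sample_pair[OF Q K.p[OF e] K.q[OF e] K.p_neq_q[OF e] w])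
  qed
  then have "AE x in ?Q. edge_product F (\<lambda>i j. W (x i) (x j)) = K.hom_term (\<lambda>i. i) x"
  proof eventually_elim
    case (elim x)
    then show ?case
      unfolding edge_product_def K.hom_term_def using K.p_neq_q by (intro prod.cong) auto
  qed
  then have "density_graphon F W = (\<integral>x. K.hom_term (\<lambda>i. i) x \<partial>?Q)"
    unfolding density_graphon_def
    by (rule integral_completion_cong_AE[rotated]) (rule kernel_sample.hom_term_sample_measurable[OF Q'], simp)
  also have "\<dots> = K.hom_density"
    by (rule kernel_sample.integral_hom_term[OF Q']) auto
  finally have limit: "density_graphon F W = K.hom_density" .

  interpret S: kernel_sample M n "X n" ?E ?k Min Max w for n
    using kernel assms(4,5)
    by (simp only: kernel_sample_def uniform_sample_def uniform_sample_axioms_def)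
  let ?S = "\<lambda>n \<omega>. (\<Sum>\<phi>\<in>{1..?k} \<rightarrow>\<^sub>E {1..n}. K.hom_term \<phi> (\<lambda>i. X n i \<omega>)) / real n ^ ?k"
  \<comment> \<open>One null event serves all sample sizes, edges and pairs, as there are countably
    many. Pairs with equal indices are left out; there both sides of the comparison below are
    zero.\<close>
  have "AE \<omega> in M. \<forall>n. \<forall>e\<in>?E. \<forall>i\<in>{1..n}. \<forall>j\<in>{1..n} - {i}. w e (X n i \<omega>, X n j \<omega>)
      = blinfun_apply (W (X n i \<omega>) (X n j \<omega>)) (edge_dec F e)"
    unfolding AE_all_countable
  proof (intro allI AE_finite_allI K.finite_E)
    fix n i j :: nat and e assume "e \<in> ?E" "i \<in> {1..n}" "j \<in> {1..n} - {i}"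
    then show "AE \<omega> in M. w e (X n i \<omega>, X n j \<omega>)
        = blinfun_apply (W (X n i \<omega>) (X n j \<omega>)) (edge_dec F e)"
      by (intro S.AE_sample_pair[where f = "w e" and g = "\<lambda>s t. blinfun_apply (W s t) (edge_dec F e)"] w)
        auto
  qed auto
  then have sampled: "AE \<omega> in M. \<forall>n. density_graph F (sampled_graph n W (\<lambda>i. X n i \<omega>)) = ?S n \<omega>"
  proof eventually_elim
    case (elim \<omega>)
    have "edge_product F (\<lambda>i j. if \<phi> i = \<phi> j then 0 else W (X n (\<phi> i) \<omega>) (X n (\<phi> j) \<omega>))
        = K.hom_term \<phi> (\<lambda>i. X n i \<omega>)" if \<phi>: "\<phi> \<in> {1..?k} \<rightarrow>\<^sub>E {1..n}" for n \<phi>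
      unfolding edge_product_def K.hom_term_def
    proof (rule prod.cong[OF refl])
      fix e assume e: "e \<in> ?E"
      have "\<phi> (Min e) \<in> {1..n}" "\<phi> (Max e) \<in> {1..n}"
        using \<phi> K.p[OF e] K.q[OF e] by (auto simp del: atLeastAtMost_iff)
      then show "blinfun_apply (if \<phi> (Min e) = \<phi> (Max e) then 0
            else W (X n (\<phi> (Min e)) \<omega>) (X n (\<phi> (Max e)) \<omega>)) (edge_dec F e)
          = (if \<phi> (Min e) = \<phi> (Max e) then 0 else w e (X n (\<phi> (Min e)) \<omega>, X n (\<phi> (Max e)) \<omega>))"
        using elim e by simp
    qed
    then show ?case
      by (simp add: density_graph_def sampled_graph_def)
  qed

  have "AE \<omega> in M. (\<lambda>n. ?S (Suc n) \<omega> - K.hom_density) \<longlonglongrightarrow> 0"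
  proof (rule AE_tendsto_zero_if_summable_power4)
    let ?c = "448 * (K.moment + K.hom_density ^ 4) * (real ?k ^ 4 + real ?k ^ 8)"
    show "integrable M (\<lambda>\<omega>. (?S (Suc n) \<omega> - K.hom_density) ^ 4)" for n
      by (rule S.integrable_sample_density4) simp
    have "summable (\<lambda>n. ?c * inverse ((real (Suc n))\<^sup>2))"
      by (intro summable_mult, subst summable_Suc_iff) (rule inverse_power_summable, simp)
    then show "summable (\<lambda>n. \<integral>\<omega>. (?S (Suc n) \<omega> - K.hom_density) ^ 4 \<partial>M)"
    proof (rule summable_comparison_test'[where N = 0])
      fix n
      have "(\<integral>\<omega>. (?S (Suc n) \<omega> - K.hom_density) ^ 4 \<partial>M) \<le> ?c / (real (Suc n))\<^sup>2"
        by (rule S.sample_density4_le) simp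
      then show "norm (\<integral>\<omega>. (?S (Suc n) \<omega> - K.hom_density) ^ 4 \<partial>M) \<le> ?c * inverse ((real (Suc n))\<^sup>2)"
        by (simp add: divide_inverse)
    qed
  qed
  with sampled show ?thesis
  proof eventually_elim
    case (elim \<omega>)
    then have "(\<lambda>n. ?S (Suc n) \<omega>) \<longlonglongrightarrow> K.hom_density"
      by (simp add: LIM_zero_iff)
    then have "(\<lambda>n. ?S n \<omega>) \<longlonglongrightarrow> K.hom_density"
      by (rule LIMSEQ_imp_Suc)
    then show ?case
      using elim(1) limit by simp
  qed
qed

end
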